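(* Let $X$ be a CBB$(0)$ space, let $Y$ be a complete CAT$(0)$ space and let $A \subseteq X$ be nonempty. Then there exists a continuous mapping $\beta_c : \mathcal{L}(A,Y) \to \mathcal{L}(X,Y)$ such that for all $g \in \mathcal{L}(A,Y)$, $\beta_c(g)(a) = g(a)$ for every $a \in A$, $\mathrm{Lip}(\beta_c(g),X) = \mathrm{Lip}(g,A)$ and $\beta_c(g)(X) \subseteq \overline{\mathrm{co}}(g(A))$.
   Context: A geodesic space is CAT$(0)$ (resp. CBB$(0)$) if for every geodesic triangle, distances between points on it are $\le$ (resp. $\ge$) distances between corresponding points of its Euclidean comparison triangle. $\mathcal{L}(A,Y)$ is the set of bounded Lipschitz maps $A\to Y$ with the supremum metric; $\mathrm{Lip}(f,B)$ is the smallest Lipschitz constant of $f$ on $B$. For $C\subseteq Y$, $G_1(C)$ is the union of all geodesic segments with endpoints in $C$, $G_n(C)=G_1(G_{n-1}(C))$, $\mathrm{co}(C)=\bigcup_n G_n(C)$, and $\overline{\mathrm{co}}(C)$ is its closure. *)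

theory Defs
  imports "HOL-Analysis.Analysis" "HOL-Library.FuncSet"
begin

definition geodesic_from :: "'a::metric_space \<Rightarrow> 'a \<Rightarrow> (real \<Rightarrow> 'a) \<Rightarrow> bool" where
  "geodesic_from x y g \<longleftrightarrow> g 0 = x \<and> g (dist x y) = y \<and>
     (\<forall>s\<in>{0..dist x y}. \<forall>t\<in>{0..dist x y}. dist (g s) (g t) = \<bar>s - t\<bar>)"

definition geodesic_space :: "'a::metric_space itself \<Rightarrow> bool" where
  "geodesic_space _ \<longleftrightarrow> (\<forall>x y::'a. \<exists>g. geodesic_from x y g)"

text \<open>Pairs (point on the side [x,y] of a geodesic triangle, corresponding point on the
  side [ex,ey] of the Euclidean comparison triangle in the plane).\<close>
definition side_pairs :: "(real \<Rightarrow> 'a::metric_space) \<Rightarrow> 'a \<Rightarrow> 'a \<Rightarrow> complex \<Rightarrow> complex \<Rightarrow> ('a \<times> complex) set" where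
  "side_pairs g x y ex ey =
     {(g s, ex + (s / dist x y) *\<^sub>R (ey - ex)) | s. s \<in> {0..dist x y}}"

definition triangle_comparison :: "'a::metric_space itself \<Rightarrow> (real \<Rightarrow> real \<Rightarrow> bool) \<Rightarrow> bool" where
  "triangle_comparison _ R \<longleftrightarrow>
     (\<forall>(x::'a) y z gxy gyz gzx (ex::complex) ey ez.
        geodesic_from x y gxy \<and> geodesic_from y z gyz \<and> geodesic_from z x gzx \<and>
        dist ex ey = dist x y \<and> dist ey ez = dist y z \<and> dist ez ex = dist z x \<longrightarrow>
        (let T = side_pairs gxy x y ex ey \<union> side_pairs gyz y z ey ez \<union> side_pairs gzx z x ez ex
         in \<forall>(p, p')\<in>T. \<forall>(q, q')\<in>T. R (dist p q) (dist p' q')))"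

definition CAT0 :: "'a::metric_space itself \<Rightarrow> bool" where
  "CAT0 t \<longleftrightarrow> geodesic_space t \<and> triangle_comparison t (\<lambda>d e. d \<le> e)"

definition CBB0 :: "'a::metric_space itself \<Rightarrow> bool" where
  "CBB0 t \<longleftrightarrow> geodesic_space t \<and> triangle_comparison t (\<lambda>d e. d \<ge> e)"

definition Lmaps :: "'a::metric_space set \<Rightarrow> ('a \<Rightarrow> 'b::metric_space) set" where
  "Lmaps A = {g. g \<in> extensional A \<and> bounded (g ` A) \<and> (\<exists>C. C-lipschitz_on A g)}"

definition supdist :: "'a set \<Rightarrow> ('a \<Rightarrow> 'b::metric_space) \<Rightarrow> ('a \<Rightarrow> 'b) \<Rightarrow> real" where
  "supdist A f g = (SUP a\<in>A. dist (f a) (g a))"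

definition Lip :: "('a::metric_space \<Rightarrow> 'b::metric_space) \<Rightarrow> 'a set \<Rightarrow> real" where
  "Lip f B = Inf {L. L-lipschitz_on B f}"

definition G1 :: "'a::metric_space set \<Rightarrow> 'a set" where
  "G1 C = {g t | x y g t. x \<in> C \<and> y \<in> C \<and> geodesic_from x y g \<and> t \<in> {0..dist x y}}"

definition Gn :: "nat \<Rightarrow> 'a::metric_space set \<Rightarrow> 'a set" where
  "Gn n C = (G1 ^^ n) C"

definition co :: "'a::metric_space set \<Rightarrow> 'a set" where
  "co C = (\<Union>n. Gn n C)"

end

(* All maps in L(A,Y) are extended simultaneously, by a Kirszbraun argument on the set of
   pairs (g, x). One asks for values F(g, x) in Y with
     d(F(g,x), F(h,y))^2 <= max(Lip g, Lip h)^2 d(x,y)^2 + K(g,h),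
   where K is a pseudometric inducing the topology of the supremum distance, large enough for
   the prescribed values F(g,a) = g(a) to satisfy the constraint. The Lang-Schroeder-Sturm
   inequality on X passes to the right-hand side, because the triangle inequality for K gives
   the analogous inequality for K; hence a finite set of constraints can be met point by point,
   provided the points are treated in the order of increasing Lip g. Asymptotic centres in Y pass
   from finite sets of points to all of them. Projecting F(g,x) to the closed convex hull of
   g(A) finally gives the operator; taking g = h shows that the Lipschitz constant is kept, taking
   x = y that the operator is continuous. *)
theory Submission
  imports Defs
begin

text \<open>The obstacle is the size of the error term. A value F(h, y) has distance at most L d(y,
  a) + \<rho> from g(a), with \<rho> the supremum distance and L = Lip h. Squaring leaves the cross
  term 2 L d(y, a) \<rho>, which grows with d(y, a). As the values belonging to h stay within b h of
  a base point z0, the factor L d(y, a) may be replaced there by 2 b h, and an error of 6 max(b g, b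
  h) \<rho> suffices. This product violates the triangle inequality: for the constant real maps 10,
  1, -1 and z0 = 0, dropping the factor 6, one gets 110 > 90 + 2. Hence the detour through a
  pseudometric K comparable to it. The bound d(z0, F(g, x)) <= b g is carried along for three
  reasons: it controls the cross term, keeps the nets bounded, and limits the distance to the hulls
  when nearest points are compared. The projection comes last because the hull varies with g. The
  dependence of a nearest point on the hull is only of square-root type, which is enough for
  continuity.\<close>

section \<open>Points on geodesics and the comparison inequalities\<close>

text \<open>A relation and not a function, because geodesics in a CBB(0) space need not be
  unique.\<close>

definition gpoint :: "'a::metric_space \<Rightarrow> 'a \<Rightarrow> real \<Rightarrow> 'a \<Rightarrow> bool" where
  "gpoint y z t m \<longleftrightarrow> (\<exists>\<gamma>. geodesic_from y z \<gamma> \<and> m = \<gamma> (t * dist y z))"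

lemma gpoint_exists:
  fixes y z :: "'a::metric_space"
  assumes "geodesic_space TYPE('a)"
  obtains m where "gpoint y z t m"
  using assms unfolding geodesic_space_def gpoint_def by blast

lemma gpoint_same:
  assumes "gpoint y y t m"
  shows "m = y"
  using assms by (auto simp: gpoint_def geodesic_from_def)

lemma gpoint_dist:
  assumes "gpoint y z t m" "0 \<le> t" "t \<le> 1"
  shows "dist y m = t * dist y z" "dist m z = (1 - t) * dist y z"
proof -
  obtain \<gamma> where g: "geodesic_from y z \<gamma>" and m: "m = \<gamma> (t * dist y z)"
    using assms(1) unfolding gpoint_def by blast
  have t: "t * dist y z \<in> {0..dist y z}"
    using assms by (simp add: mult_left_le_one_le)
  have "dist (\<gamma> 0) (\<gamma> (t * dist y z)) = \<bar>0 - t * dist y z\<bar>"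
    using g t unfolding geodesic_from_def by (meson atLeastAtMost_iff order_refl zero_le_dist)
  then show "dist y m = t * dist y z"
    using g m assms by (simp add: geodesic_from_def)
  have "dist (\<gamma> (t * dist y z)) (\<gamma> (dist y z)) = \<bar>t * dist y z - dist y z\<bar>"
    using g t unfolding geodesic_from_def by (meson atLeastAtMost_iff order_refl zero_le_dist)
  then show "dist m z = (1 - t) * dist y z"
    using g m t by (simp add: geodesic_from_def algebra_simps)
qed

lemma comparison_triangle_exists:
  fixes a b c :: real
  assumes "0 \<le> a" "0 \<le> b" "0 \<le> c" "a \<le> b + c" "b \<le> c + a" "c \<le> a + b"
  obtains ex ey ez :: complex where "dist ex ey = c" "dist ey ez = a" "dist ez ex = b"
proof (cases "c = 0")
  case True
  with assms show ?thesis
    by (intro that[of 0 0 "complex_of_real b"]) (auto simp: dist_norm)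
next
  case False
  with assms have c: "c > 0" by simp
  \<comment> \<open>Law of cosines: with the side of length c on the real axis and starting at 0, u
    is the abscissa of the third vertex.\<close>
  define u where "u = (b\<^sup>2 + c\<^sup>2 - a\<^sup>2) / (2 * c)"
  define v where "v = sqrt (b\<^sup>2 - u\<^sup>2)"
  have "(b + c)\<^sup>2 \<ge> a\<^sup>2" "(b - c)\<^sup>2 \<le> a\<^sup>2"
    using assms by (auto intro: power_mono simp flip: abs_le_square_iff)
  then have "\<bar>u\<bar> \<le> b"
    using c assms by (auto simp: u_def abs_le_iff field_simps power2_eq_square)
  then have "u\<^sup>2 \<le> b\<^sup>2"
    using assms by (simp flip: abs_le_square_iff)
  then have v: "v\<^sup>2 = b\<^sup>2 - u\<^sup>2"
    by (simp add: v_def)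
  have uc: "2 * c * u = b\<^sup>2 + c\<^sup>2 - a\<^sup>2"
    using c by (simp add: u_def)
  show ?thesis
  proof (rule that[of 0 "Complex c 0" "Complex u v"])
    show "dist 0 (Complex c 0) = c"
      using c by (simp add: dist_norm cmod_def)
    have "(c - u)\<^sup>2 + v\<^sup>2 = a\<^sup>2"
      using uc v by (simp add: power2_diff algebra_simps)
    then show "dist (Complex c 0) (Complex u v) = a"
      using assms by (simp add: dist_norm cmod_def complex_diff)
    show "dist (Complex u v) 0 = b"
      using v assms by (simp add: dist_norm cmod_def)
  qed
qed

lemma dist_affine_square:
  fixes u v w :: complex
  shows "(dist u (v + t *\<^sub>R (w - v)))\<^sup>2 =
    (1 - t) * (dist u v)\<^sup>2 + t * (dist u w)\<^sup>2 - t * (1 - t) * (dist v w)\<^sup>2"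
  unfolding dist_norm cmod_power2 by (simp add: algebra_simps power2_eq_square)

text \<open>Compares a vertex with a point of the opposite side; e is the Euclidean distance given
  by Stewart's formula. Keeping R abstract lets one proof serve both signs of curvature. Reflexivity
  of R settles the degenerate side y = z.\<close>

lemma triangle_comparison_vertex:
  fixes w y z m :: "'a::metric_space"
  assumes gs: "geodesic_space TYPE('a)" and tc: "triangle_comparison TYPE('a) R"
    and m: "gpoint y z t m" and t: "0 \<le> t" "t \<le> 1"
    and R: "\<And>u. 0 \<le> u \<Longrightarrow> R u u"
  obtains e where "R (dist w m) e" "0 \<le> e"
    "e\<^sup>2 = (1 - t) * (dist w y)\<^sup>2 + t * (dist w z)\<^sup>2 - t * (1 - t) * (dist y z)\<^sup>2"
proof (cases "y = z")
  case True
  then have "m = y" using m gpoint_same by blast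
  with True show ?thesis
    by (intro that[of "dist w m"]) (auto simp: R algebra_simps)
next
  case False
  obtain \<gamma> where g: "geodesic_from y z \<gamma>" and m: "m = \<gamma> (t * dist y z)"
    using m unfolding gpoint_def by blast
  obtain gwy gzw where gg: "geodesic_from w y gwy" "geodesic_from z w gzw"
    using gs unfolding geodesic_space_def by blast
  obtain ew ey ez :: complex where e: "dist ew ey = dist w y" "dist ey ez = dist y z"
      "dist ez ew = dist z w"
    using comparison_triangle_exists[of "dist y z" "dist z w" "dist w y"]
    by (metis add.commute dist_commute dist_triangle zero_le_dist)
  define e where "e = dist ew (ey + t *\<^sub>R (ez - ey))"
  have 1: "(w, ew) \<in> side_pairs gwy w y ew ey"
    using gg unfolding side_pairs_def geodesic_from_def by force
  have 2: "(m, ey + t *\<^sub>R (ez - ey)) \<in> side_pairs \<gamma> y z ey ez"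
    unfolding side_pairs_def
    using False t m by (auto intro!: exI[of _ "t * dist y z"] simp: mult_left_le_one_le)
  have "R (dist w m) e"
    using tc[unfolded triangle_comparison_def Let_def, rule_format,
        OF conjI[OF gg(1) conjI[OF g conjI[OF gg(2) conjI[OF e(1) conjI[OF e(2) e(3)]]]]]]
      1 2 unfolding e_def by blast
  moreover have "e\<^sup>2 = (1 - t) * (dist w y)\<^sup>2 + t * (dist w z)\<^sup>2 - t * (1 - t) * (dist y z)\<^sup>2"
    unfolding e_def dist_affine_square using e by (simp add: dist_commute)
  ultimately show ?thesis
    using that[of e] by (simp add: e_def)
qed

text \<open>From here on the curvature bounds are used only through this inequality and its reverse
  \<open>CBB0_ineq\<close>.\<close>

lemma CAT0_ineq:
  fixes w y z m :: "'b::metric_space"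
  assumes "CAT0 TYPE('b)" "gpoint y z t m" "0 \<le> t" "t \<le> 1"
  shows "(dist w m)\<^sup>2 \<le> (1 - t) * (dist w y)\<^sup>2 + t * (dist w z)\<^sup>2 - t * (1 - t) * (dist y z)\<^sup>2"
proof -
  have "geodesic_space TYPE('b)" "triangle_comparison TYPE('b) (\<lambda>d e. d \<le> e)"
    using assms(1) by (auto simp: CAT0_def)
  from triangle_comparison_vertex[OF this assms(2-4), of w] show ?thesis
    by (metis order_refl power_mono zero_le_dist)
qed

lemma CBB0_ineq:
  fixes w y z m :: "'a::metric_space"
  assumes "CBB0 TYPE('a)" "gpoint y z t m" "0 \<le> t" "t \<le> 1"
  shows "(dist w m)\<^sup>2 \<ge> (1 - t) * (dist w y)\<^sup>2 + t * (dist w z)\<^sup>2 - t * (1 - t) * (dist y z)\<^sup>2"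
proof -
  have "geodesic_space TYPE('a)" "triangle_comparison TYPE('a) (\<lambda>d e. d \<ge> e)"
    using assms(1) by (auto simp: CBB0_def)
  from triangle_comparison_vertex[OF this assms(2-4), of w] show ?thesis
    by (metis order_refl power_mono)
qed

subsection \<open>The Lang-Schroeder-Sturm inequality\<close>

text \<open>By the law of cosines, this is the Euclidean inner product of the comparison vectors
  from p to x and from p to y.\<close>

definition ip :: "'a::metric_space \<Rightarrow> 'a \<Rightarrow> 'a \<Rightarrow> real" where
  "ip p x y = ((dist p x)\<^sup>2 + (dist p y)\<^sup>2 - (dist x y)\<^sup>2) / 2"

lemma ip_commute: "ip p x y = ip p y x"
  by (simp add: ip_def dist_commute)

lemma ip_self: "ip p x x = (dist p x)\<^sup>2"
  by (simp add: ip_def)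

lemma ip_ge: "ip p x y \<ge> - (dist p x * dist p y)"
proof -
  have "(dist x y)\<^sup>2 \<le> (dist p x + dist p y)\<^sup>2"
    by (intro power_mono) (auto simp: dist_triangle3)
  then show ?thesis
    by (simp add: ip_def power2_sum)
qed

text \<open>Monotonicity of comparison angles in nonnegative curvature: moving x towards p along a
  geodesic does not decrease the angle at p, so the inner product divided by the length does not
  increase.\<close>

lemma ip_contract:
  fixes p x y q :: "'a::metric_space"
  assumes "CBB0 TYPE('a)" "gpoint p x t q" "0 \<le> t" "t \<le> 1"
  shows "ip p q y \<le> t * ip p x y"
proof -
  have "dist p q = t * dist p x"
    using gpoint_dist assms by blast
  then show ?thesis
    using CBB0_ineq[OF assms, of y]
    by (simp add: ip_def power_mult_distrib dist_commute field_simps power2_eq_square)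
qed

lemma ip_contract2:
  fixes p x y q :: "'a::metric_space"
  assumes "CBB0 TYPE('a)" "gpoint p x s q" "gpoint p y t r" "0 \<le> s" "s \<le> 1" "0 \<le> t" "t \<le> 1"
  shows "ip p q r \<le> s * t * ip p x y"
proof -
  have "ip p q r \<le> s * ip p x r"
    using ip_contract assms by blast
  also have "\<dots> \<le> s * (t * ip p x y)"
    using ip_contract[OF assms(1,3,6,7), of x] assms by (intro mult_left_mono) (auto simp: ip_commute)
  finally show ?thesis by simp
qed

text \<open>Repeated contraction has to stay on one chosen geodesic, since another geodesic with the
  same endpoints could pass through other points.\<close>

lemma geodesic_halve:
  assumes g: "geodesic_from p x \<gamma>" and "0 \<le> t" "t \<le> 1"
  shows "gpoint p (\<gamma> (t * dist p x)) (1 / 2) (\<gamma> (t / 2 * dist p x))"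
proof -
  have d: "dist p (\<gamma> (t * dist p x)) = t * dist p x"
    using gpoint_dist assms gpoint_def by blast
  have le: "t * dist p x \<le> dist p x"
    using assms by (simp add: mult_left_le_one_le)
  have "geodesic_from p (\<gamma> (t * dist p x)) \<gamma>"
    unfolding geodesic_from_def d using g le by (auto simp: geodesic_from_def)
  then show ?thesis
    unfolding gpoint_def d by (metis mult_1 times_divide_eq_left)
qed

text \<open>For vectors based at p with z = 2 x and m = (x + y) / 2, both claims are equalities with
  \<Delta> = 0. Thus \<Delta> measures how far the inner product is from homogeneous, and it is the
  only price for replacing x and y by their midpoint.\<close>

lemma midpoint_merge:
  fixes p x y z m :: "'a::metric_space"
  assumes cbb: "CBB0 TYPE('a)" and x: "gpoint p z (1/2) x" and m: "gpoint x y (1/2) m"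
  defines "\<Delta> \<equiv> ip p z y - 2 * ip p x y"
  shows "2 * ip p m q \<le> ip p x q + ip p y q + \<Delta>"
    and "4 * ip p m m \<le> ip p x x + ip p y y + 2 * ip p x y + 4 * \<Delta>"
proof -
  have px: "dist p z = 2 * dist p x" "dist x z = dist p x"
    using gpoint_dist[OF x] by simp_all
  have xm: "dist x m = dist x y / 2"
    using gpoint_dist[OF m] by simp
  \<comment> \<open>Comparison bounds distances to m from below only; an upper bound on the distance from p
    to m is available because the geodesic from p to x extends to z.\<close>
  have 1: "(dist x m)\<^sup>2 \<ge> (dist p m)\<^sup>2 / 2 + (dist z m)\<^sup>2 / 2 - (dist p z)\<^sup>2 / 4"
    using CBB0_ineq[OF cbb x, of m] by (simp add: dist_commute)
  have mid: "(dist w m)\<^sup>2 \<ge> (dist x w)\<^sup>2 / 2 + (dist y w)\<^sup>2 / 2 - (dist x y)\<^sup>2 / 4" for w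
    using CBB0_ineq[OF cbb m, of w] by (simp add: dist_commute)
  have 2: "(dist p m)\<^sup>2 - (dist p x)\<^sup>2 / 4 - (dist p y)\<^sup>2 / 4 - ip p x y / 2 \<le> \<Delta>"
    using 1 mid[of z] px(2) unfolding px(1) xm \<Delta>_def ip_def
    by (simp add: dist_commute power_divide power_mult_distrib field_simps)
  show "4 * ip p m m \<le> ip p x x + ip p y y + 2 * ip p x y + 4 * \<Delta>"
    using 2 by (simp add: ip_self field_simps)
  have "2 * ip p m q \<le> ip p x q + ip p y q
      + ((dist p m)\<^sup>2 - (dist p x)\<^sup>2 / 4 - (dist p y)\<^sup>2 / 4 - ip p x y / 2)"
    using mid[of q] by (simp add: ip_def dist_commute field_simps)
  with 2 show "2 * ip p m q \<le> ip p x q + ip p y q + \<Delta>"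
    by linarith
qed

lemma double_sum_insert:
  fixes k :: "'i \<Rightarrow> 'i \<Rightarrow> real"
  assumes "finite J" "a \<notin> J" "\<And>i j. k i j = k j i"
  shows "(\<Sum>i\<in>insert a J. \<Sum>j\<in>insert a J. k i j) =
    k a a + 2 * (\<Sum>j\<in>J. k a j) + (\<Sum>i\<in>J. \<Sum>j\<in>J. k i j)"
proof -
  have "(\<Sum>i\<in>J. k i a) = (\<Sum>j\<in>J. k a j)"
    using assms(3) by (intro sum.cong) auto
  then show ?thesis
    using assms by (simp add: sum.distrib)
qed

text \<open>By induction on the number of points: contract the points towards p by a factor tending to 0
  and replace two of them by their midpoint. The error is of smaller order than the square of the
  factor, because the rescaled inner product of the two points is monotone and bounded.\<close>
lemma ip_double_sum_nonneg:
  fixes x :: "'i \<Rightarrow> 'a::metric_space"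
  assumes cbb: "CBB0 TYPE('a)" and "finite I" "\<forall>i\<in>I. 0 \<le> w i"
  shows "0 \<le> (\<Sum>i\<in>I. \<Sum>j\<in>I. w i * w j * ip p (x i) (x j))"
  using assms(2,3)
proof (induction I arbitrary: x w)
  case empty
  then show ?case by simp
next
  case (insert a I)
  show ?case
  proof (cases "I = {}")
    case True
    then show ?thesis by (simp add: ip_self)
  next
    case False
    then obtain b where b: "b \<in> I" by blast
    define J where "J = I - {b}"
    have I: "I = insert b J" "b \<notin> J" "finite J" "a \<notin> J" "a \<noteq> b"
      using b insert.hyps by (auto simp: J_def)
    \<comment> \<open>Dividing by W turns the weights into contraction factors in [0, 1]; the
      summand 1 keeps W positive.\<close>
    define W where "W = 1 + sum w (insert a I)"
    have w: "0 \<le> w i" "w i \<le> W" if "i \<in> insert a I" for i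
    proof -
      show "0 \<le> w i" using that insert.prems by blast
      have "w i \<le> sum w (insert a I)"
        using that insert.prems insert.hyps by (intro member_le_sum) auto
      then show "w i \<le> W" by (simp add: W_def)
    qed
    have W: "W > 0"
      using insert.prems sum_nonneg[of "insert a I" w] by (fastforce simp: W_def)
    have "\<forall>i. \<exists>\<gamma>. geodesic_from p (x i) \<gamma>"
      using cbb by (auto simp: CBB0_def geodesic_space_def)
    then obtain \<gamma> where \<gamma>: "\<And>i. geodesic_from p (x i) (\<gamma> i)" by metis
    \<comment> \<open>The weight is built into the contraction, so the contracted points enter the
      sums below with weight 1.\<close>
    define t where "t i k = w i / W * (1/2) ^ k" for i and k :: nat
    define q where "q i k = \<gamma> i (t i k * dist p (x i))" for i and k :: nat
    have t: "0 \<le> t i k" "t i k \<le> 1" if "i \<in> insert a I" for i k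
    proof -
      show "0 \<le> t i k" using w[OF that] W by (simp add: t_def)
      have "w i / W * (1/2) ^ k \<le> 1 * 1"
        using w[OF that] W by (intro mult_mono power_le_one) auto
      then show "t i k \<le> 1" by (simp add: t_def)
    qed
    have q: "gpoint p (x i) (t i k) (q i k)" for i k
      using \<gamma> gpoint_def q_def by blast
    have half: "gpoint p (q i k) (1/2) (q i (Suc k))" if "i \<in> insert a I" for i k
      using geodesic_halve[OF \<gamma> t[OF that], of i k] by (simp add: q_def t_def)
    \<comment> \<open>Each step halves both points, so 4 is the rescaling under which
      \<open>ip_contract2\<close> makes \<kappa> decreasing.\<close>
    define \<kappa> where "\<kappa> k = 4 ^ k * ip p (q a k) (q b k)" for k
    have dec: "\<kappa> (Suc k) \<le> \<kappa> k" for k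
      using ip_contract2[OF cbb half half, of a b k k] I by (simp add: \<kappa>_def)
    have low: "- (w a / W * (w b / W) * (dist p (x a) * dist p (x b))) \<le> \<kappa> k" for k
    proof -
      have "dist p (q i k) = t i k * dist p (x i)" if "i \<in> insert a I" for i
        using gpoint_dist q t that by blast
      then have "- (t a k * dist p (x a) * (t b k * dist p (x b))) \<le> ip p (q a k) (q b k)"
        using ip_ge[of p "q a k" "q b k"] b by simp
      then have "4 ^ k * - (t a k * dist p (x a) * (t b k * dist p (x b))) \<le> \<kappa> k"
        unfolding \<kappa>_def by (intro mult_left_mono) auto
      moreover have "4 ^ k * (t a k * dist p (x a) * (t b k * dist p (x b))) =
          4 ^ k * ((1/2) ^ k * (1/2) ^ k) * (w a / W * (w b / W) * (dist p (x a) * dist p (x b)))"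
        unfolding t_def by (simp only: mult_ac)
      moreover have "(4::real) ^ k * ((1/2) ^ k * (1/2) ^ k) = 1"
        by (simp flip: power_mult_distrib)
      ultimately show ?thesis by simp
    qed
    have "convergent \<kappa>"
      using dec low decseq_convergent[of \<kappa>] by (metis convergent_def decseq_SucI)
    then have lim: "(\<lambda>k. \<kappa> k - \<kappa> (Suc k)) \<longlonglongrightarrow> 0"
      using LIMSEQ_Suc tendsto_diff by (fastforce simp: convergent_def)
    define S where "S = (\<Sum>i\<in>insert a I. \<Sum>j\<in>insert a I. w i * w j * ip p (x i) (x j))"
    \<comment> \<open>\<open>4 + 2 * card J\<close> is the coefficient of \<Delta> after merging two
      points; the rest comes from multiplying by \<open>4 ^ Suc k * W\<^sup>2\<close> and from the
      half in the bound for \<open>4 ^ k * \<Delta>\<close>.\<close>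
    define N where "N = (4 + 2 * real (card J)) * (2 * W\<^sup>2)"
    have "0 \<le> S + N * (\<kappa> k - \<kappa> (Suc k))" for k
    proof -
      define c where "c i = q i (Suc k)" for i
      obtain m where m: "gpoint (c a) (c b) (1/2) m"
        using gpoint_exists cbb CBB0_def by blast
      define \<Delta> where "\<Delta> = ip p (q a k) (c b) - 2 * ip p (c a) (c b)"
      have "ip p (q a k) (c b) \<le> ip p (q a k) (q b k) / 2"
        using ip_contract[OF cbb half[of b k], of "q a k"] b by (simp add: c_def ip_commute)
      then have "4 ^ k * \<Delta> \<le> 4 ^ k * (ip p (q a k) (q b k) / 2 - 2 * ip p (c a) (c b))"
        by (intro mult_left_mono) (auto simp: \<Delta>_def)
      then have \<Delta>: "4 ^ k * \<Delta> \<le> (\<kappa> k - \<kappa> (Suc k)) / 2"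
        by (simp add: \<kappa>_def c_def algebra_simps)
      note mm = midpoint_merge[OF cbb half[of a k, simplified] m[unfolded c_def], folded c_def, folded \<Delta>_def]
      \<comment> \<open>The midpoint takes the place of b and a is dropped, so the induction
        hypothesis for I applies. The weight 2 is due to m standing for half of the sum of two
        vectors.\<close>
      define x' where "x' = c(b := m)"
      define w' where "w' = (\<lambda>i. 1 :: real)(b := 2)"
      let ?SJ = "\<Sum>i\<in>J. \<Sum>j\<in>J. ip p (c i) (c j)"
      have "0 \<le> (\<Sum>i\<in>I. \<Sum>j\<in>I. w' i * w' j * ip p (x' i) (x' j))"
        by (rule insert.IH) (auto simp: w'_def)
      also have "\<dots> = 4 * ip p m m + 2 * (\<Sum>j\<in>J. 2 * ip p m (c j)) + ?SJ"
        unfolding I(1) using I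
        by (subst double_sum_insert)
           (auto simp: x'_def w'_def ip_commute intro!: arg_cong2[where f = "(+)"] sum.cong)
      also have "\<dots> \<le> (ip p (c a) (c a) + ip p (c b) (c b) + 2 * ip p (c a) (c b) + 4 * \<Delta>)
          + 2 * (\<Sum>j\<in>J. ip p (c a) (c j) + ip p (c b) (c j) + \<Delta>) + ?SJ"
        by (intro add_mono mult_left_mono sum_mono mm) auto
      also have "\<dots> = (\<Sum>i\<in>insert a I. \<Sum>j\<in>insert a I. ip p (c i) (c j))
          + (4 + 2 * real (card J)) * \<Delta>"
        unfolding I(1) using I
        by (simp add: double_sum_insert ip_commute sum.distrib algebra_simps)
      also have "(\<Sum>i\<in>insert a I. \<Sum>j\<in>insert a I. ip p (c i) (c j)) \<le>
          (\<Sum>i\<in>insert a I. \<Sum>j\<in>insert a I. t i (Suc k) * t j (Suc k) * ip p (x i) (x j))"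
        unfolding c_def by (intro sum_mono ip_contract2[OF cbb q q] t)
      also have "\<dots> = S * ((1/4) ^ Suc k / W\<^sup>2)"
      proof -
        have "(1/2::real) ^ Suc k * (1/2) ^ Suc k = (1/4) ^ Suc k"
          by (simp flip: power_mult_distrib)
        then have "t i (Suc k) * t j (Suc k) = w i * w j * ((1/4) ^ Suc k / W\<^sup>2)" for i j
          unfolding t_def power2_eq_square by (metis (no_types, lifting) mult.assoc mult.left_commute times_divide_times_eq times_divide_eq_right times_divide_eq_left)
        then show ?thesis
          unfolding S_def sum_distrib_right by (simp only: mult_ac)
      qed
      finally have "0 \<le> (S * ((1/4) ^ Suc k / W\<^sup>2) + (4 + 2 * real (card J)) * \<Delta>) * (4 ^ Suc k * W\<^sup>2)"
        by simp
      also have "\<dots> = S * (4 ^ Suc k * (1/4) ^ Suc k) + (4 + 2 * real (card J)) * (4 * W\<^sup>2) * (4 ^ k * \<Delta>)"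
        using W by (simp add: field_simps)
      also have "\<dots> = S + (4 + 2 * real (card J)) * (4 * W\<^sup>2) * (4 ^ k * \<Delta>)"
        by (simp only: flip: power_mult_distrib) simp
      also have "\<dots> \<le> S + (4 + 2 * real (card J)) * (4 * W\<^sup>2) * ((\<kappa> k - \<kappa> (Suc k)) / 2)"
        using \<Delta> by (intro add_left_mono mult_left_mono) auto
      finally show ?thesis by (simp add: N_def mult_ac)
    qed
    moreover have "(\<lambda>k. S + N * (\<kappa> k - \<kappa> (Suc k))) \<longlonglongrightarrow> S + N * 0"
      by (intro tendsto_intros lim)
    ultimately have "0 \<le> S"
      by (intro LIMSEQ_le_const) auto
    then show ?thesis by (simp add: S_def)
  qed
qed

text \<open>In Euclidean space this says that the second moment about p is at least the one about
  the mean. Here the inner products in \<open>ip_double_sum_nonneg\<close> are expanded, and the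
  weights sum to 1.\<close>

lemma lang_schroeder_sturm:
  fixes x :: "'i \<Rightarrow> 'a::metric_space"
  assumes cbb: "CBB0 TYPE('a)" and "finite I" "\<forall>i\<in>I. 0 \<le> w i" "sum w I = 1"
  shows "(\<Sum>i\<in>I. \<Sum>j\<in>I. w i * w j * (dist (x i) (x j))\<^sup>2) \<le> 2 * (\<Sum>i\<in>I. w i * (dist p (x i))\<^sup>2)"
proof -
  have *: "(\<Sum>i\<in>I. \<Sum>j\<in>I. w i * w j * f i) = (\<Sum>i\<in>I. w i * f i)"
          "(\<Sum>i\<in>I. \<Sum>j\<in>I. w i * w j * f j) = (\<Sum>i\<in>I. w i * f i)" for f
  proof -
    show "(\<Sum>i\<in>I. \<Sum>j\<in>I. w i * w j * f i) = (\<Sum>i\<in>I. w i * f i)"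
      using assms(4) by (simp add: mult_ac flip: sum_distrib_left)
    show "(\<Sum>i\<in>I. \<Sum>j\<in>I. w i * w j * f j) = (\<Sum>i\<in>I. w i * f i)"
      using assms(4) by (simp add: mult.assoc flip: sum_distrib_left sum_distrib_right)
  qed
  have "0 \<le> 2 * (\<Sum>i\<in>I. \<Sum>j\<in>I. w i * w j * ip p (x i) (x j))"
    using ip_double_sum_nonneg assms by simp
  also have "\<dots> = (\<Sum>i\<in>I. \<Sum>j\<in>I. w i * w j * (dist p (x i))\<^sup>2 + w i * w j * (dist p (x j))\<^sup>2
      - w i * w j * (dist (x i) (x j))\<^sup>2)"
    unfolding ip_def sum_distrib_left by (intro sum.cong refl) (simp add: field_simps)
  finally show ?thesis
    by (simp add: sum.distrib sum_subtractf *)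
qed

subsection \<open>Strongly convex functions on CAT(0) spaces\<close>

text \<open>Compare b and d with the midpoint of the diagonal from a to c, then join them through
  that midpoint.\<close>

lemma CAT0_quadrilateral:
  fixes a b c d :: "'b::metric_space"
  assumes cat: "CAT0 TYPE('b)"
  shows "(dist a c)\<^sup>2 + (dist b d)\<^sup>2 \<le> (dist a b)\<^sup>2 + (dist b c)\<^sup>2 + (dist c d)\<^sup>2 + (dist d a)\<^sup>2"
proof -
  obtain m where m: "gpoint a c (1/2) m"
    using gpoint_exists cat CAT0_def by blast
  have *: "(dist w m)\<^sup>2 \<le> (dist w a)\<^sup>2 / 2 + (dist w c)\<^sup>2 / 2 - (dist a c)\<^sup>2 / 4" for w
    using CAT0_ineq[OF cat m, of w] by simp
  have "(dist b d)\<^sup>2 \<le> (dist b m + dist d m)\<^sup>2"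
    by (intro power_mono) (auto simp: dist_triangle2)
  also have "\<dots> \<le> 2 * (dist b m)\<^sup>2 + 2 * (dist d m)\<^sup>2"
    using sum_squares_bound[of "dist b m" "dist d m"] by (simp add: power2_sum)
  finally show ?thesis
    using *[of b] *[of d] by (simp add: dist_commute field_simps)
qed

text \<open>Comparison on each geodesic in turn leaves the squared diagonals from y to z' and from z
  to y'; the quadrilateral inequality trades them for the sides.\<close>

lemma CAT0_geodesic_pair:
  fixes y z y' z' m m' :: "'b::metric_space"
  assumes cat: "CAT0 TYPE('b)" and m: "gpoint y z t m" and m': "gpoint y' z' t m'"
    and t: "0 \<le> t" "t \<le> 1"
  shows "(dist m m')\<^sup>2 \<le> (1 - t) * (dist y y')\<^sup>2 + t * (dist z z')\<^sup>2"
proof -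
  have "(dist m m')\<^sup>2 \<le> (1 - t) * (dist m y')\<^sup>2 + t * (dist m z')\<^sup>2 - t * (1 - t) * (dist y' z')\<^sup>2"
    using CAT0_ineq[OF cat m' t] .
  also have "\<dots> \<le> (1 - t) * ((1 - t) * (dist y' y)\<^sup>2 + t * (dist y' z)\<^sup>2 - t * (1 - t) * (dist y z)\<^sup>2)
      + t * ((1 - t) * (dist z' y)\<^sup>2 + t * (dist z' z)\<^sup>2 - t * (1 - t) * (dist y z)\<^sup>2)
      - t * (1 - t) * (dist y' z')\<^sup>2"
    using t CAT0_ineq[OF cat m t, of y'] CAT0_ineq[OF cat m t, of z'] by (intro diff_mono add_mono mult_left_mono) (auto simp: dist_commute)
  also have "\<dots> = (1 - t)\<^sup>2 * (dist y y')\<^sup>2 + t\<^sup>2 * (dist z z')\<^sup>2 +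
      t * (1 - t) * ((dist y z')\<^sup>2 + (dist z y')\<^sup>2 - (dist y z)\<^sup>2 - (dist y' z')\<^sup>2)"
    by (simp add: dist_commute algebra_simps power2_eq_square)
  also have "\<dots> \<le> (1 - t)\<^sup>2 * (dist y y')\<^sup>2 + t\<^sup>2 * (dist z z')\<^sup>2 +
      t * (1 - t) * ((dist y y')\<^sup>2 + (dist z z')\<^sup>2)"
    using t CAT0_quadrilateral[OF cat, of y z' z y']
    by (intro add_left_mono mult_left_mono) (auto simp: dist_commute)
  also have "\<dots> = (1 - t) * (dist y y')\<^sup>2 + t * (dist z z')\<^sup>2"
    by (simp add: algebra_simps power2_eq_square)
  finally show ?thesis .
qed

text \<open>The modulus is normalised so that, by \<open>CAT0_ineq\<close>, squared distances to a
  point qualify; averages of them then do too.\<close>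

definition strongly_convex :: "('b::metric_space \<Rightarrow> real) \<Rightarrow> bool" where
  "strongly_convex F \<longleftrightarrow> (\<forall>y z t m. 0 \<le> t \<longrightarrow> t \<le> 1 \<longrightarrow> gpoint y z t m \<longrightarrow>
     F m \<le> (1 - t) * F y + t * F z - t * (1 - t) * (dist y z)\<^sup>2)"

lemma G1_closedD:
  assumes "G1 S \<subseteq> S" "y \<in> S" "z \<in> S" "gpoint y z t m" "0 \<le> t" "t \<le> 1"
  shows "m \<in> S"
proof -
  obtain \<gamma> where "geodesic_from y z \<gamma>" "m = \<gamma> (t * dist y z)"
    using assms(4) unfolding gpoint_def by blast
  moreover have "t * dist y z \<in> {0..dist y z}"
    using assms(5,6) by (simp add: mult_left_le_one_le)
  ultimately have "m \<in> G1 S"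
    using assms(2,3) unfolding G1_def by blast
  then show ?thesis using assms(1) by blast
qed

text \<open>Only S is assumed convex, and the minimiser is sought in its closure: minimising
  sequences and test points are taken in S and passed to the limit, so convexity of the closure
  never has to be proved.\<close>

lemma strongly_convex_minimizer:
  fixes F :: "'b::complete_space \<Rightarrow> real"
  assumes gs: "geodesic_space TYPE('b)" and S: "S \<noteq> {}" "G1 S \<subseteq> S"
    and cont: "continuous_on UNIV F" and sc: "strongly_convex F" and low: "\<And>y. y \<in> S \<Longrightarrow> c \<le> F y"
  shows "\<exists>b \<in> closure S. \<forall>z \<in> closure S. F z \<ge> F b + (dist b z)\<^sup>2"
proof -
  define I where "I = Inf (F ` S)"
  have bdd: "bdd_below (F ` S)" using low by (rule bdd_belowI2)
  then have I: "I \<le> F y" if "y \<in> S" for y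
    using that by (auto simp: I_def intro: cInf_lower)
  have "\<exists>y\<in>S. F y < I + 1 / Suc n" for n
    using cInf_less_iff[OF _ bdd, of "I + 1 / Suc n"] S by (auto simp: I_def)
  then obtain y where y: "\<And>n. y n \<in> S" "\<And>n. F (y n) < I + 1 / Suc n"
    by metis
  have conv: "F m \<le> (1 - t) * F u + t * F v - t * (1 - t) * (dist u v)\<^sup>2"
    if "0 \<le> t" "t \<le> 1" "gpoint u v t m" for u v t m
    using sc that unfolding strongly_convex_def by blast
  have Flim: "(\<lambda>n. F (y n)) \<longlonglongrightarrow> I"
  proof (rule tendsto_sandwich[OF _ _ tendsto_const])
    have "(\<lambda>n. I + 1 / real (Suc n)) \<longlonglongrightarrow> I + 0"
      by (intro tendsto_add tendsto_const LIMSEQ_Suc lim_1_over_n)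
    then show "(\<lambda>n. I + 1 / real (Suc n)) \<longlonglongrightarrow> I" by simp
    show "\<forall>\<^sub>F n in sequentially. F (y n) \<le> I + 1 / real (Suc n)"
      using y(2) by (intro always_eventually allI less_imp_le)
  qed (use I y in auto)
  \<comment> \<open>The midpoint of two members lies in S and has value at least I, so strong
    convexity bounds their distance.\<close>
  have close: "(dist (y i) (y j))\<^sup>2 \<le> 2 * (F (y i) - I) + 2 * (F (y j) - I)" for i j
  proof -
    obtain m where m: "gpoint (y i) (y j) (1/2) m"
      using gpoint_exists gs by blast
    then have "m \<in> S"
      using G1_closedD[OF S(2) y(1) y(1) m] by simp
    then show ?thesis
      using conv[OF _ _ m] I[of m] by simp
  qed
  have "Cauchy y"
  proof (rule metric_CauchyI)
    fix e :: real assume "e > 0"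
    then have "\<forall>\<^sub>F n in sequentially. F (y n) < I + e\<^sup>2 / 4"
      by (intro order_tendstoD[OF Flim]) simp
    then obtain M where M: "\<And>n. n \<ge> M \<Longrightarrow> F (y n) < I + e\<^sup>2 / 4"
      by (auto simp: eventually_sequentially)
    have "dist (y i) (y j) < e" if "i \<ge> M" "j \<ge> M" for i j
    proof -
      have "(dist (y i) (y j))\<^sup>2 < e\<^sup>2"
        using close[of i j] M[OF that(1)] M[OF that(2)] by simp
      then show ?thesis using \<open>e > 0\<close> power_less_imp_less_base by fastforce
    qed
    then show "\<exists>M. \<forall>m\<ge>M. \<forall>n\<ge>M. dist (y m) (y n) < e" by blast
  qed
  then obtain b where b: "y \<longlonglongrightarrow> b"
    using Cauchy_convergent convergent_def by blast
  have "(\<lambda>n. F (y n)) \<longlonglongrightarrow> F b"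
    using cont b by (auto intro: continuous_on_tendsto_compose)
  then have Fb: "F b = I" using Flim LIMSEQ_unique by blast
  have *: "F z \<ge> I + (dist b z)\<^sup>2" if z: "z \<in> S" for z
  proof -
    \<comment> \<open>Convexity along the geodesic from \<open>y n\<close> to z yields, in the
      limit, an inequality with a common factor t. Cancelling it and letting t tend to 0 gives the
      full constant 1.\<close>
    have "F z \<ge> I + (1 - t) * (dist b z)\<^sup>2" if t: "0 < t" "t < 1" for t
    proof -
      have "I \<le> (1 - t) * F (y n) + t * F z - t * (1 - t) * (dist (y n) z)\<^sup>2" for n
      proof -
        obtain m where m: "gpoint (y n) z t m"
          using gpoint_exists gs by blast
        then have "m \<in> S"
          using G1_closedD[OF S(2) y(1) z m] t by simp
        then show ?thesis
          using conv[OF _ _ m] I[of m] t by simp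
      qed
      moreover have "(\<lambda>n. (1 - t) * F (y n) + t * F z - t * (1 - t) * (dist (y n) z)\<^sup>2)
          \<longlonglongrightarrow> (1 - t) * I + t * F z - t * (1 - t) * (dist b z)\<^sup>2"
        by (intro tendsto_intros Flim b)
      ultimately have "I \<le> (1 - t) * I + t * F z - t * (1 - t) * (dist b z)\<^sup>2"
        by (intro LIMSEQ_le_const) auto
      then have "0 \<le> t * (F z - I - (1 - t) * (dist b z)\<^sup>2)"
        by (simp add: algebra_simps)
      then show ?thesis
        using t by (simp add: zero_le_mult_iff)
    qed
    then have "\<forall>\<^sub>F t in at_right 0. I + (1 - t) * (dist b z)\<^sup>2 \<le> F z"
      by (auto simp: eventually_at_right[of 0 "1::real"] intro!: exI[of _ 1])
    moreover have "((\<lambda>t::real. I + (1 - t) * (dist b z)\<^sup>2) \<longlongrightarrow> I + (1 - 0) * (dist b z)\<^sup>2) (at_right 0)"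
      by (intro tendsto_intros)
    ultimately have "I + (1 - 0) * (dist b z)\<^sup>2 \<le> F z"
      by (intro tendsto_upperbound[of _ _ "at_right 0"]) auto
    then show ?thesis by simp
  qed
  show ?thesis
  proof (intro bexI ballI)
    show "b \<in> closure S"
      using b y(1) closure_sequential by blast
    fix z assume "z \<in> closure S"
    then obtain u where u: "\<And>n. u n \<in> S" "u \<longlonglongrightarrow> z"
      using closure_sequential by metis
    have "(\<lambda>n. F (u n)) \<longlonglongrightarrow> F z"
      using cont u(2) by (auto intro: continuous_on_tendsto_compose)
    moreover have "(\<lambda>n. I + (dist b (u n))\<^sup>2) \<longlonglongrightarrow> I + (dist b z)\<^sup>2"
      by (intro tendsto_intros u)
    ultimately show "F z \<ge> F b + (dist b z)\<^sup>2"
      unfolding Fb using * u(1) by (intro LIMSEQ_le[of _ _ "\<lambda>n. F (u n)"]) auto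
  qed
qed

lemma strongly_convex_minimizer_UNIV:
  fixes F :: "'b::complete_space \<Rightarrow> real"
  assumes "CAT0 TYPE('b)" "continuous_on UNIV F" "strongly_convex F" "\<And>y. 0 \<le> F y"
  shows "\<exists>b. \<forall>z. F z \<ge> F b + (dist b z)\<^sup>2"
  using strongly_convex_minimizer[of UNIV F 0] assms by (auto simp: CAT0_def)

section \<open>Limits of bounded nets and asymptotic centres\<close>

text \<open>By Tychonoff's theorem, the filter has a cluster point in a product of compact
  intervals. The refinement G does the work of an ultrafilter, with one filter for all coordinates
  k.\<close>

lemma bounded_net_limit:
  fixes u :: "'i \<Rightarrow> 'k \<Rightarrow> real"
  assumes "F \<noteq> bot" and bnd: "\<And>i k. u i k \<in> {0..c k}"
  obtains G \<psi> where "G \<noteq> bot" "G \<le> F" "\<And>k. ((\<lambda>i. u i k) \<longlongrightarrow> \<psi> k) G"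
proof -
  define P where "P = (Pi UNIV (\<lambda>k. {0..c k}))"
  have "compactin (product_topology (\<lambda>k. euclidean) UNIV) (PiE UNIV (\<lambda>k. {0..c k}))"
    by (subst compactin_PiE) auto
  then have "compact P"
    by (simp add: euclidean_product_topology P_def PiE_UNIV_domain)
  moreover have "filtermap u F \<noteq> bot"
    using assms(1) by (simp add: filtermap_bot_iff)
  moreover have "\<forall>\<^sub>F x in filtermap u F. x \<in> P"
    using bnd by (auto simp: eventually_filtermap P_def)
  ultimately obtain \<psi> where \<psi>: "inf (nhds \<psi>) (filtermap u F) \<noteq> bot"
    unfolding compact_filter by blast
  \<comment> \<open>The cluster point lives in the function space; pulling its neighbourhoods back
    along u gives a filter on the indices.\<close>
  define G where "G = inf F (filtercomap u (nhds \<psi>))"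
  have "G \<noteq> bot"
  proof
    assume "G = bot"
    then have "eventually (\<lambda>_. False) (inf F (filtercomap u (nhds \<psi>)))"
      by (simp add: G_def)
    then obtain Q R where Q: "eventually Q F" and R: "eventually R (filtercomap u (nhds \<psi>))"
      and QR: "\<And>i. Q i \<Longrightarrow> R i \<Longrightarrow> False"
      unfolding eventually_inf by blast
    from R obtain R' where R': "eventually R' (nhds \<psi>)" "\<And>i. R' (u i) \<Longrightarrow> R i"
      unfolding eventually_filtercomap by blast
    have "eventually (\<lambda>x. \<not> R' x) (filtermap u F)"
      unfolding eventually_filtermap using Q by eventually_elim (use QR R' in blast)
    with R'(1) have "eventually (\<lambda>_. False) (inf (nhds \<psi>) (filtermap u F))"
      unfolding eventually_inf by blast
    with \<psi> show False by (simp add: eventually_False)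
  qed
  moreover have "filterlim u (nhds \<psi>) G"
    unfolding filterlim_iff_le_filtercomap G_def by simp
  then have "((\<lambda>i. u i k) \<longlongrightarrow> \<psi> k) G" for k
    using continuous_on_tendsto_compose[OF continuous_on_product_coordinates[of k]] by fastforce
  ultimately show ?thesis
    using that[of G \<psi>] by (simp add: G_def)
qed

lemma dist_square_strongly_convex:
  fixes x :: "'b::metric_space"
  assumes "CAT0 TYPE('b)"
  shows "strongly_convex (\<lambda>y. (dist x y)\<^sup>2)"
  unfolding strongly_convex_def using CAT0_ineq[OF assms] by blast

text \<open>The asymptotic centre of a bounded net plays the role of a weak limit.\<close>
lemma asymptotic_centre:
  fixes f :: "'i \<Rightarrow> 'p \<Rightarrow> 'b::complete_space"
  assumes cat: "CAT0 TYPE('b)" and F: "F \<noteq> bot" and bnd: "\<And>i p. dist z0 (f i p) \<le> c p"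
  obtains \<phi> where "\<And>p y D. \<forall>\<^sub>F i in F. dist (f i p) y \<le> D \<Longrightarrow> dist (\<phi> p) y \<le> D"
    and "\<And>p q D. \<forall>\<^sub>F i in F. dist (f i p) (f i q) \<le> D \<Longrightarrow> dist (\<phi> p) (\<phi> q) \<le> D"
proof -
  have bnd': "dist (f i (fst k)) (snd k) \<in> {0..c (fst k) + dist z0 (snd k)}" for i k
    using bnd[where p = "fst k" and i = i] dist_triangle3[of "f i (fst k)" "snd k" z0] by simp
  \<comment> \<open>The coordinates are all pairs of an index p and a point of Y, so every limiting
    distance function exists along the same G.\<close>
  obtain G \<psi> where G: "G \<noteq> bot" "G \<le> F"
    and lim': "\<And>k. ((\<lambda>i. dist (f i (fst k)) (snd k)) \<longlongrightarrow> \<psi> k) G"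
    by (rule bounded_net_limit[where u = "\<lambda>i k. dist (f i (fst k)) (snd k)", OF F bnd']) (rule that)
  have lim: "((\<lambda>i. dist (f i p) y) \<longlongrightarrow> \<psi> (p, y)) G" for p y
    using lim'[of "(p, y)"] by simp
  have ev: "eventually P F \<Longrightarrow> eventually P G" for P
    using G(2) by (simp add: le_filter_def)
  have nonneg: "0 \<le> \<psi> (p, y)" for p y
    by (rule tendsto_lowerbound[OF lim _ G(1)]) simp
  have "\<exists>b. \<forall>z. (\<psi> (p, z))\<^sup>2 \<ge> (\<psi> (p, b))\<^sup>2 + (dist b z)\<^sup>2" for p
  proof -
    have "strongly_convex (\<lambda>y. (\<psi> (p, y))\<^sup>2)"
      unfolding strongly_convex_def
    proof (intro allI impI)
      fix y z m :: 'b and t :: real assume "0 \<le> t" "t \<le> 1" "gpoint y z t m"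
      then have "\<forall>\<^sub>F i in G. (dist (f i p) m)\<^sup>2 \<le> (1 - t) * (dist (f i p) y)\<^sup>2
          + t * (dist (f i p) z)\<^sup>2 - t * (1 - t) * (dist y z)\<^sup>2"
        using CAT0_ineq[OF cat] by (intro always_eventually allI) blast
      then show "(\<psi> (p, m))\<^sup>2 \<le> (1 - t) * (\<psi> (p, y))\<^sup>2 + t * (\<psi> (p, z))\<^sup>2 - t * (1 - t) * (dist y z)\<^sup>2"
        by (rule tendsto_le[OF G(1), rotated 2]) (intro tendsto_intros lim)+
    qed
    moreover have "continuous_on UNIV (\<lambda>y. (\<psi> (p, y))\<^sup>2)"
    proof -
      have "\<psi> (p, y) \<le> \<psi> (p, z) + dist y z" for y z
        by (rule tendsto_le[OF G(1) tendsto_add[OF lim tendsto_const] lim])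
           (intro always_eventually allI dist_triangle2)
      then have "dist (\<psi> (p, y)) (\<psi> (p, z)) \<le> 1 * dist y z" for y z
        by (smt (verit) dist_commute dist_real_def mult_1)
      then have "1-lipschitz_on UNIV (\<lambda>y. \<psi> (p, y))"
        by (intro lipschitz_onI) auto
      then show ?thesis
        by (intro continuous_on_power lipschitz_on_continuous_on)
    qed
    ultimately show ?thesis
      using strongly_convex_minimizer_UNIV[OF cat, of "\<lambda>y. (\<psi> (p, y))\<^sup>2"] by simp
  qed
  then obtain \<phi> where \<phi>: "\<And>p z. (\<psi> (p, z))\<^sup>2 \<ge> (\<psi> (p, \<phi> p))\<^sup>2 + (dist (\<phi> p) z)\<^sup>2"
    by metis
  show ?thesis
  proof (rule that)
    fix p y D assume "\<forall>\<^sub>F i in F. dist (f i p) y \<le> D"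
    then have D: "\<psi> (p, y) \<le> D"
      by (intro tendsto_upperbound[OF lim _ G(1)] ev)
    have "(dist (\<phi> p) y)\<^sup>2 \<le> (\<psi> (p, y))\<^sup>2"
      using \<phi>[of p y] by (smt (verit) zero_le_power2)
    then show "dist (\<phi> p) y \<le> D"
      using D nonneg power2_le_imp_le by (meson order_trans)
  next
    fix p q D assume D: "\<forall>\<^sub>F i in F. dist (f i p) (f i q) \<le> D"
    then obtain i where "dist (f i p) (f i q) \<le> D"
      using F eventually_happens' by blast
    then have "0 \<le> D" by (meson order_trans zero_le_dist)
    \<comment> \<open>In the limit, the diagonals exceed the sides at \<open>\<phi> p\<close> and
      \<open>\<phi> q\<close> by at least two copies of the squared distance of the centres, by
      minimality of each. The quadrilateral inequality gives back only one copy, so the other is at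
      most \<open>D\<^sup>2\<close>.\<close>
    have "\<forall>\<^sub>F i in G. (dist (f i p) (\<phi> q))\<^sup>2 + (dist (f i q) (\<phi> p))\<^sup>2 \<le>
        (dist (f i p) (\<phi> p))\<^sup>2 + (dist (\<phi> p) (\<phi> q))\<^sup>2 + (dist (f i q) (\<phi> q))\<^sup>2 + D\<^sup>2"
      using ev[OF D]
    proof eventually_elim
      case (elim i)
      then have "(dist (f i p) (f i q))\<^sup>2 \<le> D\<^sup>2"
        by (intro power_mono) auto
      then show ?case
        using CAT0_quadrilateral[OF cat, of "f i p" "\<phi> q" "\<phi> p" "f i q"] by (simp add: dist_commute)
    qed
    then have "(\<psi> (p, \<phi> q))\<^sup>2 + (\<psi> (q, \<phi> p))\<^sup>2 \<le>
        (\<psi> (p, \<phi> p))\<^sup>2 + (dist (\<phi> p) (\<phi> q))\<^sup>2 + (\<psi> (q, \<phi> q))\<^sup>2 + D\<^sup>2"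
      by (rule tendsto_le[OF G(1), rotated 2]) (intro tendsto_intros lim)+
    then have "(dist (\<phi> p) (\<phi> q))\<^sup>2 \<le> D\<^sup>2"
      using \<phi>[of p "\<phi> q"] \<phi>[of q "\<phi> p"] by (simp add: dist_commute)
    then show "dist (\<phi> p) (\<phi> q) \<le> D"
      using \<open>0 \<le> D\<close> power2_le_imp_le by blast
  qed
qed

lemma barycentre_exists:
  fixes y :: "'i \<Rightarrow> 'b::complete_space"
  assumes cat: "CAT0 TYPE('b)" and I: "finite I" "\<forall>i\<in>I. 0 \<le> w i" "sum w I = 1"
  shows "\<exists>b. \<forall>z. (\<Sum>i\<in>I. w i * (dist z (y i))\<^sup>2) \<ge> (\<Sum>i\<in>I. w i * (dist b (y i))\<^sup>2) + (dist b z)\<^sup>2"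
proof -
  define F where "F z = (\<Sum>i\<in>I. w i * (dist z (y i))\<^sup>2)" for z
  have "strongly_convex F"
    unfolding strongly_convex_def
  proof (intro allI impI)
    fix u v m :: 'b and t :: real assume t: "0 \<le> t" "t \<le> 1" and m: "gpoint u v t m"
    have "F m \<le> (\<Sum>i\<in>I. w i * ((1 - t) * (dist u (y i))\<^sup>2 + t * (dist v (y i))\<^sup>2 - t * (1 - t) * (dist u v)\<^sup>2))"
      unfolding F_def using CAT0_ineq[OF cat m t] I
      by (intro sum_mono mult_left_mono) (auto simp: dist_commute[of _ "y _"])
    also have "\<dots> = (1 - t) * F u + t * F v - sum w I * (t * (1 - t) * (dist u v)\<^sup>2)"
      unfolding F_def sum_distrib_left sum_distrib_right sum.distrib[symmetric] sum_subtractf[symmetric]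
      by (intro sum.cong refl) (simp add: algebra_simps)
    finally show "F m \<le> (1 - t) * F u + t * F v - t * (1 - t) * (dist u v)\<^sup>2"
      by (simp add: I)
  qed
  moreover have "continuous_on UNIV F"
    unfolding F_def by (intro continuous_intros)
  moreover have "0 \<le> F z" for z
    unfolding F_def using I by (intro sum_nonneg) auto
  ultimately have "\<exists>b. \<forall>z. F z \<ge> F b + (dist b z)\<^sup>2"
    using cat by (intro strongly_convex_minimizer_UNIV)
  then show ?thesis unfolding F_def .
qed

subsection \<open>One-point Lipschitz extension\<close>

text \<open>A minimax argument: the infimum over the points b of the maximum over i of
  the excess over r i is dual to a supremum over the weights w of the value at the barycentre;
  the barycentre of nearly optimal weights is nearly optimal.\<close>
lemma ball_intersection_approx:
  fixes y :: "'i \<Rightarrow> 'b::complete_space"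
  assumes cat: "CAT0 TYPE('b)" and I: "finite I"
    and H: "\<And>w. \<forall>i\<in>I. 0 \<le> w i \<Longrightarrow> sum w I = 1 \<Longrightarrow>
      (\<Sum>i\<in>I. \<Sum>j\<in>I. w i * w j * (dist (y i) (y j))\<^sup>2) \<le> 2 * (\<Sum>i\<in>I. w i * r i)"
    and \<epsilon>: "\<epsilon> > 0"
  obtains b where "\<forall>i\<in>I. (dist b (y i))\<^sup>2 \<le> r i + \<epsilon>"
proof (cases "I = {}")
  case True
  with that show ?thesis by simp
next
  case False
  then obtain i0 where i0: "i0 \<in> I" by blast
  define \<Lambda> where "\<Lambda> = {w. (\<forall>i\<in>I. 0 \<le> w i) \<and> sum w I = (1::real)}"
  define F where "F w z = (\<Sum>i\<in>I. w i * (dist z (y i))\<^sup>2)" for w z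
  have ex: "\<exists>b. \<forall>z. F w z \<ge> F w b + (dist b z)\<^sup>2" if "w \<in> \<Lambda>" for w
  proof -
    have w: "\<forall>i\<in>I. 0 \<le> w i" "sum w I = 1"
      using that by (auto simp: \<Lambda>_def)
    then show ?thesis
      unfolding F_def by (rule barycentre_exists[OF cat I])
  qed
  define b where "b w = (SOME b. \<forall>z. F w z \<ge> F w b + (dist b z)\<^sup>2)" for w
  have b: "F w z \<ge> F w (b w) + (dist (b w) z)\<^sup>2" if "w \<in> \<Lambda>" for w z
    using someI_ex[OF ex[OF that]] unfolding b_def by (rule spec)
  define D where "D w = F w (b w) - (\<Sum>i\<in>I. w i * r i)" for w
  have Dle: "D w \<le> 0" if w: "w \<in> \<Lambda>" for w
  proof -
    \<comment> \<open>Averaging the variance inequality of the barycentre over the points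
      \<open>y j\<close> produces the double sum in H.\<close>
    have "2 * F w (b w) = (\<Sum>j\<in>I. w j * (F w (b w) + (dist (b w) (y j))\<^sup>2))"
      using w by (simp add: \<Lambda>_def distrib_left sum.distrib F_def flip: sum_distrib_right)
    also have "\<dots> \<le> (\<Sum>j\<in>I. w j * F w (y j))"
      using w b by (intro sum_mono mult_left_mono) (auto simp: \<Lambda>_def)
    also have "\<dots> = (\<Sum>i\<in>I. \<Sum>j\<in>I. w i * w j * (dist (y i) (y j))\<^sup>2)"
      by (simp add: F_def sum_distrib_left mult.assoc)
    also have "\<dots> \<le> 2 * (\<Sum>i\<in>I. w i * r i)"
      using w by (intro H) (auto simp: \<Lambda>_def)
    finally show ?thesis by (simp add: D_def)
  qed
  define M where "M = 1 + (\<Sum>i\<in>I. \<Sum>j\<in>I. (dist (y i) (y j))\<^sup>2)"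
  have M: "(dist (y i) (y j))\<^sup>2 \<le> M" if "i \<in> I" "j \<in> I" for i j
  proof -
    have "(dist (y i) (y j))\<^sup>2 \<le> (\<Sum>j\<in>I. (dist (y i) (y j))\<^sup>2)"
      using that I by (intro member_le_sum) auto
    also have "\<dots> \<le> (\<Sum>i\<in>I. \<Sum>j\<in>I. (dist (y i) (y j))\<^sup>2)"
      using that I by (intro member_le_sum[of i I "\<lambda>i. \<Sum>j\<in>I. (dist (y i) (y j))\<^sup>2"] sum_nonneg) auto
    finally show ?thesis by (simp add: M_def)
  qed
  have "M \<ge> 1" by (auto simp: M_def intro!: sum_nonneg)
  have R: "(dist (b w) (y i))\<^sup>2 \<le> M" if w: "w \<in> \<Lambda>" and i: "i \<in> I" for w i
  proof -
    have "F w (y i) \<le> (\<Sum>j\<in>I. w j * M)"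
      unfolding F_def using w M i by (intro sum_mono mult_left_mono) (auto simp: \<Lambda>_def)
    also have "\<dots> = M"
      using w by (simp add: \<Lambda>_def flip: sum_distrib_right)
    finally have "F w (y i) \<le> M" .
    moreover have "0 \<le> F w (b w)"
      unfolding F_def using w by (intro sum_nonneg) (auto simp: \<Lambda>_def)
    ultimately show ?thesis using b[OF w, of "y i"] by linarith
  qed
  \<comment> \<open>The error budget is \<open>t * \<epsilon>\<close>: this choice of t keeps the
    second-order error \<open>2 * t\<^sup>2 * d\<^sup>2\<close> within one half, and \<eta> is the
    other half.\<close>
  define t where "t = min (1/2) (\<epsilon> / (4 * M))"
  have t: "0 < t" "t \<le> 1/2" "4 * t * M \<le> \<epsilon>"
    using \<epsilon> \<open>M \<ge> 1\<close> by (auto simp: t_def field_simps min_def)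
  define \<eta> where "\<eta> = t * \<epsilon> / 2"
  have "\<eta> > 0" using t \<epsilon> by (simp add: \<eta>_def)
  have delta: "(\<lambda>j. if j = i then 1 else 0) \<in> \<Lambda>" if "i \<in> I" for i
    using that I by (simp add: \<Lambda>_def)
  have bdd: "bdd_above (D ` \<Lambda>)"
    using Dle by (rule bdd_aboveI2)
  have ne: "D ` \<Lambda> \<noteq> {}" using delta[OF i0] by blast
  obtain w where w: "w \<in> \<Lambda>" "D w > Sup (D ` \<Lambda>) - \<eta>"
    using less_cSup_iff[OF ne bdd, of "Sup (D ` \<Lambda>) - \<eta>"] \<open>\<eta> > 0\<close> by auto
  show ?thesis
  proof (rule that, intro ballI)
    fix i assume i: "i \<in> I"
    \<comment> \<open>Moving weight t onto i raises D by at most \<eta>, while a shift of the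
      barycentre by s costs \<open>(1 - t) * s\<^sup>2\<close>. This bounds the excess at i, first
      for \<open>b v\<close> and then for \<open>b w\<close>.\<close>
    define v where "v j = (1 - t) * w j + t * (if j = i then 1 else 0)" for j
    have vsum: "(\<Sum>j\<in>I. v j * g j) = (1 - t) * (\<Sum>j\<in>I. w j * g j) + t * g i" for g
    proof -
      have "(\<Sum>j\<in>I. v j * g j) = (\<Sum>j\<in>I. (1 - t) * (w j * g j) + (if j = i then t * g j else 0))"
        unfolding v_def by (intro sum.cong) (auto simp: algebra_simps)
      then show ?thesis
        using i I by (simp add: sum.distrib sum_distrib_left)
    qed
    have v: "v \<in> \<Lambda>"
      using w(1) t vsum[of "\<lambda>_. 1"] unfolding \<Lambda>_def by (auto simp: v_def)
    define s where "s = dist (b w) (b v)"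
    have "D v \<le> Sup (D ` \<Lambda>)"
      using v bdd by (intro cSup_upper) auto
    with w(2) have "D v \<le> D w + \<eta>" by simp
    moreover have "D v = (1 - t) * (F w (b v) - (\<Sum>i\<in>I. w i * r i)) + t * ((dist (b v) (y i))\<^sup>2 - r i)"
      unfolding D_def F_def vsum by (simp add: algebra_simps)
    moreover have "(1 - t) * (D w + s\<^sup>2) \<le> (1 - t) * (F w (b v) - (\<Sum>i\<in>I. w i * r i))"
      using b[OF w(1), of "b v"] t by (intro mult_left_mono) (auto simp: D_def s_def)
    moreover have "t * D w \<le> 0"
      using Dle[OF w(1)] t by (simp add: mult_le_0_iff)
    ultimately have 1: "t * ((dist (b v) (y i))\<^sup>2 - r i) \<le> \<eta> - (1 - t) * s\<^sup>2"
      by (simp add: algebra_simps)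
    define d where "d = dist (b w) (y i)"
    have d: "0 \<le> d" "d\<^sup>2 \<le> M" using R[OF w(1) i] by (auto simp: d_def)
    have s0: "0 \<le> s" by (simp add: s_def)
    have tri: "d \<le> s + dist (b v) (y i)"
      by (simp add: d_def s_def dist_triangle)
    have "d\<^sup>2 - 2 * s * d \<le> (dist (b v) (y i))\<^sup>2"
    proof (cases "s \<le> d")
      case True
      then have "(d - s)\<^sup>2 \<le> (dist (b v) (y i))\<^sup>2"
        using tri by (intro power_mono) auto
      moreover have "(d - s)\<^sup>2 = d\<^sup>2 - 2 * s * d + s\<^sup>2"
        by (simp add: power2_diff)
      ultimately show ?thesis using zero_le_power2[of s] by linarith
    next
      case False
      then have "d * d \<le> s * d" "0 \<le> s * d"
        using d s0 by (auto intro: mult_right_mono)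
      then show ?thesis
        using zero_le_power2[of "dist (b v) (y i)"] unfolding power2_eq_square[of d] by linarith
    qed
    then have "t * (d\<^sup>2 - 2 * s * d - r i) \<le> t * ((dist (b v) (y i))\<^sup>2 - r i)"
      using t by (intro mult_left_mono) auto
    moreover have "s\<^sup>2 / 2 \<le> (1 - t) * s\<^sup>2"
      using t mult_right_mono[of "1/2" "1 - t" "s\<^sup>2"] by simp
    \<comment> \<open>The quadratic growth at the barycentre absorbs the first-order effect of
      replacing \<open>b v\<close> by \<open>b w\<close>.\<close>
    moreover have "2 * t * s * d \<le> s\<^sup>2 / 2 + 2 * t\<^sup>2 * d\<^sup>2"
      using zero_le_power2[of "s - 2 * t * d"] by (simp add: power2_diff power_mult_distrib algebra_simps)
    moreover have "2 * t\<^sup>2 * d\<^sup>2 \<le> t * \<epsilon> / 2"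
    proof -
      have "2 * t\<^sup>2 * d\<^sup>2 \<le> 2 * t\<^sup>2 * M"
        using d by (intro mult_left_mono) auto
      also have "\<dots> = t * (4 * t * M) / 2" by (simp add: power2_eq_square)
      also have "\<dots> \<le> t * \<epsilon> / 2"
        using t by (intro divide_right_mono mult_left_mono) auto
      finally show ?thesis .
    qed
    ultimately have "t * (d\<^sup>2 - r i) \<le> t * \<epsilon>"
      using 1 unfolding \<eta>_def by (simp add: algebra_simps)
    then show "(dist (b w) (y i))\<^sup>2 \<le> r i + \<epsilon>"
      using t by (simp add: d_def)
  qed
qed

text \<open>A triple holds a point of X, its value in Y and a slack. Slacks enter additively because
  the weighted double sum of e + e' is twice the weighted sum of e, the same shape as the right side
  of \<open>lang_schroeder_sturm\<close>.\<close>

lemma kirszbraun_point_finite: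
  fixes T :: "('a::metric_space \<times> 'b::complete_space \<times> real) set"
  assumes cbb: "CBB0 TYPE('a)" and cat: "CAT0 TYPE('b)" and fin: "finite T"
    and T: "\<And>u v e u' v' e'. (u, v, e) \<in> T \<Longrightarrow> (u', v', e') \<in> T \<Longrightarrow>
      (dist v v')\<^sup>2 \<le> L\<^sup>2 * (dist u u')\<^sup>2 + e + e'"
  shows "\<exists>b. \<forall>(u, v, e) \<in> T. (dist b v)\<^sup>2 \<le> L\<^sup>2 * (dist x u)\<^sup>2 + e"
proof (cases "T = {}")
  case True
  then show ?thesis by simp
next
  case False
  then obtain u0 v0 e0 where t0: "(u0, v0, e0) \<in> T" by (metis ex_in_conv prod_cases3)
  define X :: "'a \<times> 'b \<times> real \<Rightarrow> 'a" where "X = fst"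
  define Y :: "'a \<times> 'b \<times> real \<Rightarrow> 'b" where "Y = fst \<circ> snd"
  define E :: "'a \<times> 'b \<times> real \<Rightarrow> real" where "E = snd \<circ> snd"
  define r where "r i = L\<^sup>2 * (dist x (X i))\<^sup>2 + E i" for i
  have H: "(\<Sum>i\<in>T. \<Sum>j\<in>T. w i * w j * (dist (Y i) (Y j))\<^sup>2) \<le> 2 * (\<Sum>i\<in>T. w i * r i)"
    if w: "\<forall>i\<in>T. 0 \<le> w i" "sum w T = 1" for w
  proof -
    have pw: "(dist (Y i) (Y j))\<^sup>2 \<le> L\<^sup>2 * (dist (X i) (X j))\<^sup>2 + E i + E j" if "i \<in> T" "j \<in> T" for i j
      using T that unfolding X_def Y_def E_def by (metis comp_apply prod.collapse)
    have "(\<Sum>i\<in>T. \<Sum>j\<in>T. w i * w j * (dist (Y i) (Y j))\<^sup>2) \<le>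
        (\<Sum>i\<in>T. \<Sum>j\<in>T. w i * w j * (L\<^sup>2 * (dist (X i) (X j))\<^sup>2 + E i + E j))"
      using w pw by (intro sum_mono mult_left_mono) auto
    also have "\<dots> = L\<^sup>2 * (\<Sum>i\<in>T. \<Sum>j\<in>T. w i * w j * (dist (X i) (X j))\<^sup>2)
        + (\<Sum>i\<in>T. w i * E i * sum w T) + (\<Sum>i\<in>T. w i * (\<Sum>j\<in>T. w j * E j))"
      unfolding sum_distrib_left sum.distrib[symmetric] by (intro sum.cong refl) (simp add: algebra_simps)
    also have "\<dots> = L\<^sup>2 * (\<Sum>i\<in>T. \<Sum>j\<in>T. w i * w j * (dist (X i) (X j))\<^sup>2) + 2 * (\<Sum>i\<in>T. w i * E i)"
      using w by (simp flip: sum_distrib_right)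
    also have "\<dots> \<le> L\<^sup>2 * (2 * (\<Sum>i\<in>T. w i * (dist x (X i))\<^sup>2)) + 2 * (\<Sum>i\<in>T. w i * E i)"
      using lang_schroeder_sturm[OF cbb fin w, of X x] by (intro add_right_mono mult_left_mono) auto
    also have "\<dots> = 2 * (\<Sum>i\<in>T. w i * r i)"
      by (simp add: r_def distrib_left sum.distrib sum_distrib_left mult_ac)
    finally show ?thesis .
  qed
  have "\<exists>b. \<forall>i\<in>T. (dist b (Y i))\<^sup>2 \<le> r i + 1 / Suc n" for n
    using ball_intersection_approx[OF cat fin H, of "1 / Suc n"] by auto
  then obtain b where b: "\<And>n i. i \<in> T \<Longrightarrow> (dist (b n) (Y i))\<^sup>2 \<le> r i + 1 / Suc n"
    by metis
  have "dist v0 (b n) \<le> sqrt (r (u0, v0, e0) + 1)" for n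
  proof (rule real_le_rsqrt)
    have "(dist (b n) v0)\<^sup>2 \<le> r (u0, v0, e0) + 1 / Suc n"
      using b[OF t0, of n] by (simp add: Y_def)
    moreover have "1 / real (Suc n) \<le> 1" by simp
    ultimately show "(dist v0 (b n))\<^sup>2 \<le> r (u0, v0, e0) + 1"
      unfolding dist_commute[of v0] by linarith
  qed
  \<comment> \<open>A single sequence is a family indexed by \<open>unit\<close>; its asymptotic
    centre makes the approximate solutions exact.\<close>
  then obtain \<phi> :: "unit \<Rightarrow> 'b" where
    \<phi>: "\<And>p y D. \<forall>\<^sub>F n in sequentially. dist (b n) y \<le> D \<Longrightarrow> dist (\<phi> p) y \<le> D"
    by (rule asymptotic_centre[OF cat sequentially_bot, where f = "\<lambda>n p. b n"]) (rule that, blast)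
  have "(dist (\<phi> ()) (Y i))\<^sup>2 \<le> r i" if i: "i \<in> T" for i
  proof (rule field_le_epsilon)
    fix \<epsilon> :: real assume "\<epsilon> > 0"
    then have "\<forall>\<^sub>F n in sequentially. 1 / real (Suc n) < \<epsilon>"
      using order_tendstoD(2)[OF LIMSEQ_Suc[OF lim_1_over_n]] by blast
    then have "\<forall>\<^sub>F n in sequentially. dist (b n) (Y i) \<le> sqrt (r i + \<epsilon>)"
    proof eventually_elim
      case (elim n)
      then show ?case using b[OF i, of n] by (intro real_le_rsqrt) linarith
    qed
    then have "dist (\<phi> ()) (Y i) \<le> sqrt (r i + \<epsilon>)" by (rule \<phi>)
    then show "(dist (\<phi> ()) (Y i))\<^sup>2 \<le> r i + \<epsilon>"
      by (intro sqrt_ge_absD) simp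
  qed
  then show ?thesis
    by (intro exI[of _ "\<phi> ()"]) (auto simp: X_def Y_def E_def r_def)
qed

lemma kirszbraun_point:
  fixes T :: "('a::metric_space \<times> 'b::complete_space \<times> real) set"
  assumes cbb: "CBB0 TYPE('a)" and cat: "CAT0 TYPE('b)"
    and T: "\<And>u v e u' v' e'. (u, v, e) \<in> T \<Longrightarrow> (u', v', e') \<in> T \<Longrightarrow>
      (dist v v')\<^sup>2 \<le> L\<^sup>2 * (dist u u')\<^sup>2 + e + e'"
  shows "\<exists>b. \<forall>(u, v, e) \<in> T. (dist b v)\<^sup>2 \<le> L\<^sup>2 * (dist x u)\<^sup>2 + e"
proof (cases "T = {}")
  case True
  then show ?thesis by simp
next
  case False
  then obtain u0 v0 e0 where t0: "(u0, v0, e0) \<in> T" by (metis ex_in_conv prod_cases3)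
  \<comment> \<open>Keeping one fixed triple in every finite subproblem confines all solutions to
    one ball, as asymptotic centres require.\<close>
  have "\<exists>b. \<forall>(u, v, e) \<in> insert (u0, v0, e0) (S \<inter> T). (dist b v)\<^sup>2 \<le> L\<^sup>2 * (dist x u)\<^sup>2 + e"
    if "finite S" for S
  proof (rule kirszbraun_point_finite[OF cbb cat])
    fix u v e u' v' e'
    assume "(u, v, e) \<in> insert (u0, v0, e0) (S \<inter> T)" "(u', v', e') \<in> insert (u0, v0, e0) (S \<inter> T)"
    then have "(u, v, e) \<in> T" "(u', v', e') \<in> T" using t0 by auto
    then show "(dist v v')\<^sup>2 \<le> L\<^sup>2 * (dist u u')\<^sup>2 + e + e'" by (rule T)
  qed (use that in simp)
  then obtain b where b: "\<And>S. finite S \<Longrightarrow> \<forall>(u, v, e) \<in> insert (u0, v0, e0) (S \<inter> T).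
      (dist (b S) v)\<^sup>2 \<le> L\<^sup>2 * (dist x u)\<^sup>2 + e"
    by metis
  \<comment> \<open>The filter is over all sets, so infinite ones need a value in that ball as
    well.\<close>
  define b' where "b' S = (if finite S then b S else v0)" for S
  have "dist v0 (b' S) \<le> sqrt (L\<^sup>2 * (dist x u0)\<^sup>2 + e0)" for S
    using b[of S] T[OF t0 t0] by (auto simp: b'_def dist_commute intro!: real_le_rsqrt)
  then obtain \<phi> :: "unit \<Rightarrow> 'b" where
    \<phi>: "\<And>p y D. \<forall>\<^sub>F S in finite_subsets_at_top UNIV. dist (b' S) y \<le> D \<Longrightarrow> dist (\<phi> p) y \<le> D"
    by (rule asymptotic_centre[OF cat finite_subsets_at_top_neq_bot[of UNIV], where f = "\<lambda>n p. b' n"]) (rule that, blast)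
  have "(dist (\<phi> ()) v)\<^sup>2 \<le> L\<^sup>2 * (dist x u)\<^sup>2 + e" if t: "(u, v, e) \<in> T" for u v e
  proof -
    have "\<forall>\<^sub>F S in finite_subsets_at_top UNIV. dist (b' S) v \<le> sqrt (L\<^sup>2 * (dist x u)\<^sup>2 + e)"
      unfolding eventually_finite_subsets_at_top
      using t b by (intro exI[of _ "{(u, v, e)}"]) (fastforce simp: b'_def intro!: real_le_rsqrt)
    then have "dist (\<phi> ()) v \<le> sqrt (L\<^sup>2 * (dist x u)\<^sup>2 + e)" by (rule \<phi>)
    then show ?thesis
      by (intro sqrt_ge_absD) simp
  qed
  then show ?thesis by (intro exI[of _ "\<phi> ()"]) blast
qed

subsection \<open>Closed convex hulls and nearest points\<close>

lemma G1_increasing: "C \<subseteq> G1 C"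
proof
  fix x assume "x \<in> C"
  moreover have "geodesic_from x x (\<lambda>_. x)" by (simp add: geodesic_from_def)
  ultimately show "x \<in> G1 C" unfolding G1_def by fastforce
qed

lemma Gn_0 [simp]: "Gn 0 C = C"
  by (simp add: Gn_def)

lemma Gn_Suc [simp]: "Gn (Suc n) C = G1 (Gn n C)"
  by (simp add: Gn_def)

lemma Gn_mono: "m \<le> n \<Longrightarrow> Gn m C \<subseteq> Gn n C"
  by (rule lift_Suc_mono_le[of "\<lambda>n. Gn n C"]) (auto simp: G1_increasing)

lemma subset_co: "C \<subseteq> co C"
  unfolding co_def using Gn_0 by fastforce

lemma G1_co: "G1 (co C) \<subseteq> co C"
proof
  fix p assume "p \<in> G1 (co C)"
  then obtain x y g t where p: "p = g t" "x \<in> co C" "y \<in> co C" "geodesic_from x y g" "t \<in> {0..dist x y}"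
    unfolding G1_def by blast
  then obtain m n where "x \<in> Gn m C" "y \<in> Gn n C"
    unfolding co_def by blast
  then have "x \<in> Gn (max m n) C" "y \<in> Gn (max m n) C"
    using Gn_mono by (metis max.cobounded1 max.cobounded2 subsetD)+
  with p have "p \<in> Gn (Suc (max m n)) C"
    unfolding Gn_Suc G1_def by blast
  then show "p \<in> co C" unfolding co_def by blast
qed

text \<open>Points with the same parameter on two geodesics are no farther apart than the larger
  distance between corresponding endpoints, so the error does not grow with n.\<close>

lemma Gn_near:
  fixes g h :: "'a \<Rightarrow> 'b::metric_space"
  assumes cat: "CAT0 TYPE('b)" and near: "\<And>a. a \<in> A \<Longrightarrow> dist (g a) (h a) \<le> e"
    and z: "z \<in> Gn n (g ` A)"
  shows "\<exists>z' \<in> Gn n (h ` A). dist z z' \<le> e"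
  using z
proof (induction n arbitrary: z)
  case 0
  then show ?case using near by auto
next
  case (Suc n)
  then obtain x y \<gamma> t where z: "z = \<gamma> t" "x \<in> Gn n (g ` A)" "y \<in> Gn n (g ` A)"
      "geodesic_from x y \<gamma>" "t \<in> {0..dist x y}"
    unfolding Gn_Suc G1_def by blast
  obtain x' y' where x': "x' \<in> Gn n (h ` A)" "dist x x' \<le> e" and y': "y' \<in> Gn n (h ` A)" "dist y y' \<le> e"
    using Suc.IH z(2,3) by blast
  have e: "0 \<le> e" using x'(2) by (meson order_trans zero_le_dist)
  \<comment> \<open>If x = y, then t and s are both 0 and the relation
    \<open>t = s * dist x y\<close> survives.\<close>
  define s where "s = t / dist x y"
  have s: "0 \<le> s" "s \<le> 1" "t = s * dist x y"
    using z(5) by (auto simp: s_def divide_le_eq)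
  then have m: "gpoint x y s z" using z gpoint_def by blast
  obtain \<gamma>' where \<gamma>': "geodesic_from x' y' \<gamma>'"
    using cat unfolding CAT0_def geodesic_space_def by blast
  define z' where "z' = \<gamma>' (s * dist x' y')"
  have m': "gpoint x' y' s z'" using \<gamma>' gpoint_def z'_def by blast
  have "s * dist x' y' \<in> {0..dist x' y'}"
    using s by (simp add: mult_left_le_one_le)
  then have "z' \<in> Gn (Suc n) (h ` A)"
    unfolding Gn_Suc G1_def z'_def using x' y' \<gamma>' by blast
  moreover have "(dist z z')\<^sup>2 \<le> e\<^sup>2"
  proof -
    have "(dist z z')\<^sup>2 \<le> (1 - s) * (dist x x')\<^sup>2 + s * (dist y y')\<^sup>2"
      using CAT0_geodesic_pair[OF cat m m' s(1,2)] .
    also have "\<dots> \<le> (1 - s) * e\<^sup>2 + s * e\<^sup>2"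
      using s x' y' by (intro add_mono mult_left_mono power_mono) auto
    finally show ?thesis by (simp add: algebra_simps)
  qed
  ultimately show ?case
    using e power2_le_imp_le by blast
qed

text \<open>The gap between e and e' pays for replacing a point of the closure by a point of the
  hull.\<close>

lemma closure_co_near:
  fixes g h :: "'a \<Rightarrow> 'b::metric_space"
  assumes cat: "CAT0 TYPE('b)" and near: "\<And>a. a \<in> A \<Longrightarrow> dist (g a) (h a) \<le> e"
    and z: "z \<in> closure (co (g ` A))" and "e < e'"
  shows "\<exists>z' \<in> closure (co (h ` A)). dist z z' \<le> e'"
proof -
  have "0 < e' - e" using \<open>e < e'\<close> by simp
  then obtain y where y: "y \<in> co (g ` A)" "dist y z < e' - e"
    using z unfolding closure_approachable by blast
  then obtain n where n: "y \<in> Gn n (g ` A)" unfolding co_def by blast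
  have "\<exists>z' \<in> Gn n (h ` A). dist y z' \<le> e"
    by (rule Gn_near[OF cat near n])
  then obtain z' where z': "z' \<in> Gn n (h ` A)" "dist y z' \<le> e" ..
  then have "z' \<in> co (h ` A)"
    unfolding co_def by blast
  then have "z' \<in> closure (co (h ` A))"
    using closure_subset[of "co (h ` A)"] by blast
  moreover have "dist z z' \<le> e'"
    using y z' dist_triangle3[of z z' y] by linarith
  ultimately show ?thesis by blast
qed

text \<open>Stronger than minimality: the extra term expresses that the angle at u is not acute,
  which all later estimates exploit.\<close>

definition nearest :: "'b::metric_space set \<Rightarrow> 'b \<Rightarrow> 'b \<Rightarrow> bool" where
  "nearest C y u \<longleftrightarrow> u \<in> C \<and> (\<forall>z\<in>C. (dist y u)\<^sup>2 + (dist u z)\<^sup>2 \<le> (dist y z)\<^sup>2)"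

lemma nearest_exists:
  fixes S :: "'b::complete_space set"
  assumes cat: "CAT0 TYPE('b)" and S: "S \<noteq> {}" "G1 S \<subseteq> S"
  shows "\<exists>u. nearest (closure S) y u"
proof -
  have "geodesic_space TYPE('b)" using cat by (simp add: CAT0_def)
  moreover have "continuous_on UNIV (\<lambda>z. (dist y z)\<^sup>2)"
    by (intro continuous_intros)
  ultimately show ?thesis
    using strongly_convex_minimizer[OF _ S _ dist_square_strongly_convex[OF cat], of y 0]
    unfolding nearest_def by auto
qed

lemma nearest_dist_le:
  assumes "nearest C y u" "z \<in> C"
  shows "dist y u \<le> dist y z" "dist u z \<le> dist y z"
proof -
  have "(dist y u)\<^sup>2 + (dist u z)\<^sup>2 \<le> (dist y z)\<^sup>2"
    using assms unfolding nearest_def by blast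
  then have "(dist y u)\<^sup>2 \<le> (dist y z)\<^sup>2" "(dist u z)\<^sup>2 \<le> (dist y z)\<^sup>2"
    by (smt (verit) zero_le_power2)+
  then show "dist y u \<le> dist y z" "dist u z \<le> dist y z"
    using power2_le_imp_le zero_le_dist by blast+
qed

text \<open>The angle conditions bound the diagonals from y to v and from z to u from below; the
  quadrilateral inequality bounds them from above.\<close>

lemma nearest_nonexpansive:
  fixes y z u v :: "'b::metric_space"
  assumes cat: "CAT0 TYPE('b)" and "nearest C y u" "nearest C z v"
  shows "dist u v \<le> dist y z"
proof -
  have "(dist y u)\<^sup>2 + (dist u v)\<^sup>2 \<le> (dist y v)\<^sup>2" "(dist z v)\<^sup>2 + (dist v u)\<^sup>2 \<le> (dist z u)\<^sup>2"
    using assms(2,3) unfolding nearest_def by blast+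
  moreover have "(dist y v)\<^sup>2 + (dist z u)\<^sup>2 \<le> (dist y z)\<^sup>2 + (dist z v)\<^sup>2 + (dist v u)\<^sup>2 + (dist u y)\<^sup>2"
    using CAT0_quadrilateral[OF cat, of y v z u] .
  ultimately have "(dist u v)\<^sup>2 \<le> (dist y z)\<^sup>2"
    unfolding dist_commute[of v u] dist_commute[of u y] by linarith
  then show ?thesis using power2_le_imp_le zero_le_dist by blast
qed

text \<open>Moving v into C and u into D costs e each, so u' is nearest to y in D up to 2 e. The
  angle condition turns this into a bound on a squared distance, whence the square root and the
  dependence on d.\<close>

lemma nearest_stable:
  fixes y u v :: "'b::metric_space"
  assumes u: "nearest C y u" and v: "nearest D y v"
    and CD: "\<And>z. z \<in> C \<Longrightarrow> \<exists>z'\<in>D. dist z z' \<le> e" and DC: "\<And>z. z \<in> D \<Longrightarrow> \<exists>z'\<in>C. dist z z' \<le> e"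
    and d: "dist y v \<le> d"
  shows "dist u v \<le> e + sqrt (4 * e * d + 4 * e\<^sup>2)"
proof -
  obtain u' where u': "u' \<in> D" "dist u u' \<le> e"
    using CD u unfolding nearest_def by blast
  obtain v' where v': "v' \<in> C" "dist v v' \<le> e"
    using DC v unfolding nearest_def by blast
  have e: "0 \<le> e" using u'(2) by (meson order_trans zero_le_dist)
  have "dist y u \<le> dist y v'" using nearest_dist_le u v' by blast
  also have "\<dots> \<le> dist y v + e" using v' dist_triangle[of y v' v] by linarith
  finally have "dist y u' \<le> dist y v + 2 * e" using u' dist_triangle[of y u' u] by linarith
  then have "(dist y u')\<^sup>2 \<le> (dist y v + 2 * e)\<^sup>2"
    by (intro power_mono) auto
  moreover have "(dist y v)\<^sup>2 + (dist v u')\<^sup>2 \<le> (dist y u')\<^sup>2"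
    using v u' unfolding nearest_def by blast
  ultimately have "(dist v u')\<^sup>2 \<le> 4 * e * dist y v + 4 * e\<^sup>2"
    by (simp add: power2_sum power_mult_distrib algebra_simps)
  also have "\<dots> \<le> 4 * e * d + 4 * e\<^sup>2"
    using d e by (intro add_right_mono mult_left_mono) auto
  finally have "dist v u' \<le> sqrt (4 * e * d + 4 * e\<^sup>2)"
    by (rule real_le_rsqrt)
  then show ?thesis
    using u' dist_triangle2[of u v u'] by linarith
qed

subsection \<open>Simultaneous extension\<close>

text \<open>The function K is built from bumps of height proportional to the square of b z around each z,
  with radius half of b z, so that it behaves like rho at the scale set by b.\<close>
lemma weighted_pseudometric:
  fixes \<rho> :: "'j \<Rightarrow> 'j \<Rightarrow> real" and b :: "'j \<Rightarrow> real"
  assumes refl: "\<And>i. i \<in> J \<Longrightarrow> \<rho> i i = 0"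
    and sym: "\<And>i j. i \<in> J \<Longrightarrow> j \<in> J \<Longrightarrow> \<rho> i j = \<rho> j i"
    and tri: "\<And>i j k. i \<in> J \<Longrightarrow> j \<in> J \<Longrightarrow> k \<in> J \<Longrightarrow> \<rho> i k \<le> \<rho> i j + \<rho> j k"
    and b: "\<And>i j. i \<in> J \<Longrightarrow> j \<in> J \<Longrightarrow> b i \<le> b j + \<rho> i j"
      "\<And>i j. i \<in> J \<Longrightarrow> j \<in> J \<Longrightarrow> \<rho> i j \<le> b i + b j"
  obtains K where "\<And>i. i \<in> J \<Longrightarrow> K i i = 0"
    "\<And>i j. i \<in> J \<Longrightarrow> j \<in> J \<Longrightarrow> K i j = K j i"
    "\<And>i j k. i \<in> J \<Longrightarrow> j \<in> J \<Longrightarrow> k \<in> J \<Longrightarrow> K i k \<le> K i j + K j k"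
    "\<And>i j. i \<in> J \<Longrightarrow> j \<in> J \<Longrightarrow> 6 * max (b i) (b j) * \<rho> i j \<le> K i j"
    "\<And>i j. i \<in> J \<Longrightarrow> j \<in> J \<Longrightarrow> K i j \<le> 48 * max (b i) (b j) * \<rho> i j"
proof -
  have b0: "0 \<le> b i" if "i \<in> J" for i
    using b(2)[OF that that] refl[OF that] by simp
  have r0: "0 \<le> \<rho> i j" if "i \<in> J" "j \<in> J" for i j
    using tri[OF that(1) that(2) that(1)] refl[OF that(1)] sym[OF that] by simp
  define \<phi> where "\<phi> z i = 12 * b z * max 0 (b z - 2 * \<rho> i z)" for z i
  define K where "K i j = (SUP z\<in>J. \<bar>\<phi> z i - \<phi> z j\<bar>)" for i j
  have one: "\<bar>\<phi> z i - \<phi> z j\<bar> \<le> 48 * max (b i) (b j) * \<rho> i j" if "i \<in> J" "j \<in> J" "z \<in> J" for i j z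
  proof (cases "b z \<le> 2 * \<rho> i z \<and> b z \<le> 2 * \<rho> j z")
    case True
    then have "\<phi> z i = 0" "\<phi> z j = 0" by (auto simp: \<phi>_def)
    moreover have "0 \<le> 48 * max (b i) (b j) * \<rho> i j"
      using b0[OF that(1)] r0[OF that(1,2)] by (simp add: le_max_iff_disj)
    ultimately show ?thesis by simp
  next
    case False
    \<comment> \<open>At a point i of the support, \<open>\<rho> i z < b z / 2\<close>, and b varies
      by at most \<rho>, so \<open>b z \<le> 2 * b i\<close>. This gives 48 = 12 * 2 * 2.\<close>
    then have bz: "b z \<le> 2 * max (b i) (b j)"
      using b(1)[OF that(3,1)] b(1)[OF that(3,2)] sym[OF that(3,1)] sym[OF that(3,2)]
      by (auto simp: max_def)
    have "\<bar>max 0 (b z - 2 * \<rho> i z) - max 0 (b z - 2 * \<rho> j z)\<bar> \<le> 2 * \<rho> i j"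
      using tri[OF that(1,2,3)] tri[OF that(2,1,3)] sym[OF that(1,2)] r0[OF that(1,2)]
      by (auto simp: max_def abs_le_iff)
    then have "12 * b z * \<bar>max 0 (b z - 2 * \<rho> i z) - max 0 (b z - 2 * \<rho> j z)\<bar> \<le>
        12 * (2 * max (b i) (b j)) * (2 * \<rho> i j)"
      using b0[OF that(1)] b0[OF that(3)] r0[OF that(1,2)] bz
      by (intro mult_mono) (auto simp: le_max_iff_disj)
    then show ?thesis
      using b0[OF that(3)] unfolding \<phi>_def right_diff_distrib[symmetric] abs_mult by simp
  qed
  have bdd: "bdd_above ((\<lambda>z. \<bar>\<phi> z i - \<phi> z j\<bar>) ` J)" if "i \<in> J" "j \<in> J" for i j
    using one[OF that] by (rule bdd_aboveI2)
  have upper: "\<bar>\<phi> z i - \<phi> z j\<bar> \<le> K i j" if "i \<in> J" "j \<in> J" "z \<in> J" for i j z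
    unfolding K_def using bdd that by (intro cSUP_upper) auto
  have least: "K i j \<le> M" if "i \<in> J" "\<And>z. z \<in> J \<Longrightarrow> \<bar>\<phi> z i - \<phi> z j\<bar> \<le> M" for i j M
    unfolding K_def using that by (intro cSUP_least) auto
  have Ksym: "K i j = K j i" for i j
    unfolding K_def by (simp add: abs_minus_commute)
  have low: "6 * b j * \<rho> i j \<le> K i j" if "i \<in> J" "j \<in> J" "b i \<le> b j" for i j
  proof -
    \<comment> \<open>The bump centred at j suffices. Its drop from j to i is
      \<open>12 * b j\<close> times the minimum of \<open>b j\<close> and
      \<open>2 * \<rho> i j\<close>, and \<open>\<rho> i j \<le> 2 * b j\<close> here.\<close>
    have "\<rho> i j \<le> 2 * (b j - max 0 (b j - 2 * \<rho> i j))"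
      using b(2)[OF that(1,2)] that r0[OF that(1,2)] by (simp add: max_def)
    then have "6 * b j * \<rho> i j \<le> 6 * b j * (2 * (b j - max 0 (b j - 2 * \<rho> i j)))"
      using b0[OF that(2)] by (intro mult_left_mono) auto
    also have "\<dots> = \<phi> j j - \<phi> j i"
      using b0[OF that(2)] refl[OF that(2)] by (simp add: \<phi>_def max_def algebra_simps)
    also have "\<dots> \<le> K i j"
      using upper[OF that(1,2,2)] by linarith
    finally show ?thesis .
  qed
  have K0: "K i i = 0" if "i \<in> J" for i
    using least[of i i 0] upper[of i i i] that by simp
  have Ktri: "K i k \<le> K i j + K j k" if "i \<in> J" "j \<in> J" "k \<in> J" for i j k
  proof (rule least)
    fix z assume "z \<in> J"
    then show "\<bar>\<phi> z i - \<phi> z k\<bar> \<le> K i j + K j k"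
      using upper[of i j z] upper[of j k z] that by linarith
  qed (use that in simp)
  have Klow: "6 * max (b i) (b j) * \<rho> i j \<le> K i j" if "i \<in> J" "j \<in> J" for i j
    using low[of i j] low[of j i] that sym[of i j] Ksym[of i j] by (auto simp: max_def)
  have Kup: "K i j \<le> 48 * max (b i) (b j) * \<rho> i j" if "i \<in> J" "j \<in> J" for i j
    using least one that by blast
  show ?thesis
    by (rule that[of K]) (rule K0 Ksym Ktri Klow Kup; assumption)+
qed

text \<open>Agreement with g on A is encoded as a Lipschitz bound towards every g(a), which forces
  equality when x = a. The ball about z0 is part of the induction because the cross term needs it at
  the next step.\<close>

lemma finite_simultaneous_extension:
  fixes A :: "'a::metric_space set" and J :: "('a \<Rightarrow> 'b::complete_space) set"
  assumes cbb: "CBB0 TYPE('a)" and cat: "CAT0 TYPE('b)"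
    and L: "\<And>g. g \<in> J \<Longrightarrow> (L g)-lipschitz_on A g"
    and b: "\<And>g a. g \<in> J \<Longrightarrow> a \<in> A \<Longrightarrow> dist z0 (g a) \<le> b g"
    and \<rho>: "\<And>g h a. g \<in> J \<Longrightarrow> h \<in> J \<Longrightarrow> a \<in> A \<Longrightarrow> dist (g a) (h a) \<le> \<rho> g h"
      "\<And>g h. g \<in> J \<Longrightarrow> h \<in> J \<Longrightarrow> b g \<le> b h + \<rho> g h"
      "\<And>g h. g \<in> J \<Longrightarrow> h \<in> J \<Longrightarrow> \<rho> g h \<le> b g + b h"
      "\<And>g h. g \<in> J \<Longrightarrow> h \<in> J \<Longrightarrow> \<rho> g h = \<rho> h g"
    and K: "\<And>g. g \<in> J \<Longrightarrow> K g g = 0"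
      "\<And>g h. g \<in> J \<Longrightarrow> h \<in> J \<Longrightarrow> K g h = K h g"
      "\<And>g h k. g \<in> J \<Longrightarrow> h \<in> J \<Longrightarrow> k \<in> J \<Longrightarrow> K g k \<le> K g h + K h k"
      "\<And>g h. g \<in> J \<Longrightarrow> h \<in> J \<Longrightarrow> 6 * max (b g) (b h) * \<rho> g h \<le> K g h"
    and A: "A \<noteq> {}" and S: "finite S" "S \<subseteq> J \<times> UNIV"
  shows "\<exists>F. \<forall>(g, x) \<in> S. dist z0 (F (g, x)) \<le> b g \<and> (\<forall>a\<in>A. dist (F (g, x)) (g a) \<le> L g * dist x a) \<and>
    (\<forall>(h, y) \<in> S. (dist (F (g, x)) (F (h, y)))\<^sup>2 \<le> (max (L g) (L h))\<^sup>2 * (dist x y)\<^sup>2 + K g h)"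
  using S
proof (induction S rule: finite_ranking_induct[where f = "\<lambda>p. L (fst p)"])
  case empty
  then show ?case by simp
next
  \<comment> \<open>The new point belongs to the map g with the largest Lipschitz constant, so that every
    constraint between the points present holds with the constant of g.\<close>
  case (insert p S)
  obtain g x where p: "p = (g, x)" by (cases p)
  have "S \<subseteq> J \<times> UNIV" using insert.prems by blast
  from insert.IH[OF this] obtain F where F: "\<forall>(g, x) \<in> S. dist z0 (F (g, x)) \<le> b g \<and>
    (\<forall>a\<in>A. dist (F (g, x)) (g a) \<le> L g * dist x a) \<and>
    (\<forall>(h, y) \<in> S. (dist (F (g, x)) (F (h, y)))\<^sup>2 \<le> (max (L g) (L h))\<^sup>2 * (dist x y)\<^sup>2 + K g h)" ..
  have F0: "dist z0 (F (h, y)) \<le> b h" if "(h, y) \<in> S" for h y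
    using bspec[OF F that] by simp
  have FA: "dist (F (h, y)) (h a) \<le> L h * dist y a" if "(h, y) \<in> S" "a \<in> A" for h y a
    using bspec[OF F that(1)] that(2) by simp
  have FF: "(dist (F (h, y)) (F (k, z)))\<^sup>2 \<le> (max (L h) (L k))\<^sup>2 * (dist y z)\<^sup>2 + K h k"
    if "(h, y) \<in> S" "(k, z) \<in> S" for h y k z
  proof -
    have "\<forall>(k, z) \<in> S. (dist (F (h, y)) (F (k, z)))\<^sup>2 \<le> (max (L h) (L k))\<^sup>2 * (dist y z)\<^sup>2 + K h k"
      using bspec[OF F that(1)] by simp
    from bspec[OF this that(2)] show ?thesis by simp
  qed
  have g: "g \<in> J" and SJ: "\<And>h y. (h, y) \<in> S \<Longrightarrow> h \<in> J"
    using insert.prems p by auto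
  have Lg: "L h \<le> L g" if "(h, y) \<in> S" for h y
    using insert.hyps(2)[OF that] p by simp
  have L0: "0 \<le> L h" if "h \<in> J" for h
    using L[OF that] lipschitz_on_nonneg by blast
  obtain a0 where a0: "a0 \<in> A" using A by blast
  have b0: "0 \<le> b h" if "h \<in> J" for h
    using b[OF that a0] by (meson order_trans zero_le_dist)
  have \<rho>0: "0 \<le> \<rho> h k" if "h \<in> J" "k \<in> J" for h k
    using \<rho>(1)[OF that a0] by (meson order_trans zero_le_dist)
  \<comment> \<open>The factor 6 is 4 + 2: the cross term needs \<open>4 * b h * \<rho> g h\<close>,
    and the square is at most \<open>2 * max (b g) (b h) * \<rho> g h\<close>.\<close>
  have KG: "2 * (2 * b h) * \<rho> g h + (\<rho> g h)\<^sup>2 \<le> K g h" "(b h)\<^sup>2 \<le> (b g)\<^sup>2 + K g h" if h: "h \<in> J" for h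
  proof -
    let ?m = "max (b g) (b h)"
    have m: "b g \<le> ?m" "b h \<le> ?m" by auto
    have "4 * b h * \<rho> g h \<le> 4 * ?m * \<rho> g h" "\<rho> g h * \<rho> g h \<le> (2 * ?m) * \<rho> g h"
      using m \<rho>0[OF g h] \<rho>(3)[OF g h] by (auto intro!: mult_right_mono)
    then show "2 * (2 * b h) * \<rho> g h + (\<rho> g h)\<^sup>2 \<le> K g h"
      using K(4)[OF g h] by (simp add: power2_eq_square)
    show "(b h)\<^sup>2 \<le> (b g)\<^sup>2 + K g h"
    proof (cases "b h \<le> b g")
      case True
      have "0 \<le> 6 * ?m * \<rho> g h" using m b0[OF g] \<rho>0[OF g h] by simp
      then have "0 \<le> K g h" using K(4)[OF g h] by linarith
      moreover have "(b h)\<^sup>2 \<le> (b g)\<^sup>2" using True b0[OF h] by (intro power_mono)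
      ultimately show ?thesis by simp
    next
      case False
      have "(b h)\<^sup>2 - (b g)\<^sup>2 = (b h + b g) * (b h - b g)" by (simp add: algebra_simps power2_eq_square)
      also have "\<dots> \<le> (2 * ?m) * \<rho> g h"
        using False b0[OF g] b0[OF h] \<rho>(2)[OF h g] \<rho>(4)[OF g h] \<rho>0[OF g h]
        by (intro mult_mono) auto
      also have "\<dots> \<le> 6 * ?m * \<rho> g h"
        using m b0[OF g] \<rho>0[OF g h] by (intro mult_right_mono) auto
      finally show ?thesis using K(4)[OF g h] by linarith
    qed
  qed
  \<comment> \<open>Earlier values carry the slack \<open>K g h\<close> and prescribed ones none.
    The triple placed at x itself has distance 0 to the new point, so it puts the new value into the
    ball of radius \<open>b g\<close> about z0.\<close>
  define T where "T = {(y, F (h, y), K g h) | h y. (h, y) \<in> S} \<union> {(a, g a, 0) | a. a \<in> A} \<union> {(x, z0, (b g)\<^sup>2)}"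
  have mono: "c\<^sup>2 * e \<le> (L g)\<^sup>2 * e" if "0 \<le> c" "c \<le> L g" "0 \<le> e" for c e :: real
    using that by (intro mult_right_mono power_mono)
  have SS: "(dist (F (h, y)) (F (k, z)))\<^sup>2 \<le> (L g)\<^sup>2 * (dist y z)\<^sup>2 + K g h + K g k"
    if "(h, y) \<in> S" "(k, z) \<in> S" for h y k z
  proof -
    have "h \<in> J" "k \<in> J" using that SJ by blast+
    then have "K h k \<le> K g h + K g k" using K(2,3) g by metis
    moreover have "(max (L h) (L k))\<^sup>2 * (dist y z)\<^sup>2 \<le> (L g)\<^sup>2 * (dist y z)\<^sup>2"
      using Lg that L0[OF \<open>h \<in> J\<close>] by (intro mono) (auto simp: le_max_iff_disj)
    ultimately show ?thesis using FF[OF that] by linarith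
  qed
  have SA: "(dist (F (h, y)) (g a))\<^sup>2 \<le> (L g)\<^sup>2 * (dist y a)\<^sup>2 + K g h"
    if hy: "(h, y) \<in> S" and a: "a \<in> A" for h y a
  proof -
    have h: "h \<in> J" using hy SJ by blast
    \<comment> \<open>Of the two bounds for m, the Lipschitz one is used in the square and
      \<open>2 * b h\<close> in the cross term.\<close>
    define m where "m = dist (F (h, y)) (h a)"
    have m: "0 \<le> m" "m \<le> L h * dist y a" "m \<le> 2 * b h"
      using FA[OF hy a] F0[OF hy] b[OF h a] dist_triangle3[of "F (h, y)" "h a" z0] by (auto simp: m_def)
    have "dist (F (h, y)) (g a) \<le> m + \<rho> g h"
      using \<rho>(1)[OF g h a] dist_triangle2[of "F (h, y)" "g a" "h a"] by (simp add: m_def)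
    then have "(dist (F (h, y)) (g a))\<^sup>2 \<le> (m + \<rho> g h)\<^sup>2"
      by (intro power_mono) auto
    also have "\<dots> = m\<^sup>2 + 2 * m * \<rho> g h + (\<rho> g h)\<^sup>2" by (simp add: power2_sum)
    also have "2 * m * \<rho> g h \<le> 2 * (2 * b h) * \<rho> g h"
      using m \<rho>0[OF g h] by (intro mult_right_mono) auto
    also have "m\<^sup>2 \<le> (L h * dist y a)\<^sup>2" using m by (intro power_mono)
    also have "(L h * dist y a)\<^sup>2 \<le> (L g)\<^sup>2 * (dist y a)\<^sup>2"
      unfolding power_mult_distrib using Lg[OF hy] L0[OF h] by (intro mono) auto
    finally show ?thesis using KG(1)[OF h] by linarith
  qed
  have S0: "(dist (F (h, y)) z0)\<^sup>2 \<le> (b g)\<^sup>2 + K g h" if hy: "(h, y) \<in> S" for h y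
  proof -
    have "(dist (F (h, y)) z0)\<^sup>2 \<le> (b h)\<^sup>2"
      using F0[OF hy] by (intro power_mono) (auto simp: dist_commute)
    also have "\<dots> \<le> (b g)\<^sup>2 + K g h" using KG(2) SJ hy by blast
    finally show ?thesis .
  qed
  have AA: "(dist (g a) (g a'))\<^sup>2 \<le> (L g)\<^sup>2 * (dist a a')\<^sup>2" if "a \<in> A" "a' \<in> A" for a a'
    unfolding power_mult_distrib[symmetric]
    using lipschitz_onD[OF L[OF g] that] by (intro power_mono) auto
  have A0: "(dist (g a) z0)\<^sup>2 \<le> (b g)\<^sup>2" if "a \<in> A" for a
    using b[OF g that] by (intro power_mono) (auto simp: dist_commute)
  have nn: "0 \<le> (L g)\<^sup>2 * (dist u v)\<^sup>2" for u v :: 'a by simp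
  have 1: "(dist (F (h, y)) (g a))\<^sup>2 \<le> (L g)\<^sup>2 * (dist y a)\<^sup>2 + K g h + 0"
    "(dist (g a) (F (h, y)))\<^sup>2 \<le> (L g)\<^sup>2 * (dist a y)\<^sup>2 + 0 + K g h"
    if "(h, y) \<in> S" "a \<in> A" for h y a
    using SA[OF that] by (simp_all add: dist_commute)
  have 2: "(dist (F (h, y)) z0)\<^sup>2 \<le> (L g)\<^sup>2 * (dist y x)\<^sup>2 + K g h + (b g)\<^sup>2"
    "(dist z0 (F (h, y)))\<^sup>2 \<le> (L g)\<^sup>2 * (dist x y)\<^sup>2 + (b g)\<^sup>2 + K g h"
    if "(h, y) \<in> S" for h y
    using S0[OF that] nn[of x y] nn[of y x] unfolding dist_commute[of z0] by linarith+
  have 3: "(dist (g a) z0)\<^sup>2 \<le> (L g)\<^sup>2 * (dist a x)\<^sup>2 + 0 + (b g)\<^sup>2"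
    "(dist z0 (g a))\<^sup>2 \<le> (L g)\<^sup>2 * (dist x a)\<^sup>2 + (b g)\<^sup>2 + 0"
    if "a \<in> A" for a
    using A0[OF that] nn[of x a] nn[of a x] unfolding dist_commute[of z0] by linarith+
  have 4: "(dist z0 z0)\<^sup>2 \<le> (L g)\<^sup>2 * (dist x x)\<^sup>2 + (b g)\<^sup>2 + (b g)\<^sup>2"
    by simp
  have 5: "(dist (g a) (g a'))\<^sup>2 \<le> (L g)\<^sup>2 * (dist a a')\<^sup>2 + 0 + 0" if "a \<in> A" "a' \<in> A" for a a'
    using AA[OF that] by simp
  have T: "(dist v v')\<^sup>2 \<le> (L g)\<^sup>2 * (dist u u')\<^sup>2 + e + e'"
    if "(u, v, e) \<in> T" "(u', v', e') \<in> T" for u v e u' v' e'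
    using that unfolding T_def
    by (elim UnE CollectE exE conjE singletonE Pair_inject; hypsubst) (rule SS 1 2 3 4 5; assumption)+
  have "\<exists>q. \<forall>(u, v, e) \<in> T. (dist q v)\<^sup>2 \<le> (L g)\<^sup>2 * (dist x u)\<^sup>2 + e"
    by (rule kirszbraun_point[OF cbb cat]) (rule T)
  then obtain q where q: "\<And>u v e. (u, v, e) \<in> T \<Longrightarrow> (dist q v)\<^sup>2 \<le> (L g)\<^sup>2 * (dist x u)\<^sup>2 + e"
    by fast
  have qS: "(dist q (F (h, y)))\<^sup>2 \<le> (max (L g) (L h))\<^sup>2 * (dist x y)\<^sup>2 + K g h" if "(h, y) \<in> S" for h y
  proof -
    have "max (L g) (L h) = L g" using Lg[OF that] by simp
    then show ?thesis using q[of y "F (h, y)" "K g h"] that unfolding T_def by auto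
  qed
  have qA: "dist q (g a) \<le> L g * dist x a" if "a \<in> A" for a
  proof (rule power2_le_imp_le)
    show "(dist q (g a))\<^sup>2 \<le> (L g * dist x a)\<^sup>2"
      using q[of a "g a" 0] that by (auto simp: T_def power_mult_distrib)
  qed (use L0 g in simp)
  have q0: "dist z0 q \<le> b g"
  proof (rule power2_le_imp_le)
    show "(dist z0 q)\<^sup>2 \<le> (b g)\<^sup>2"
      using q[of x z0 "(b g)\<^sup>2"] by (simp add: T_def dist_commute)
  qed (use b0 g in simp)
  define F' where "F' = F(p := q)"
  have F': "F' (g, x) = q" "\<And>h y. (h, y) \<noteq> (g, x) \<Longrightarrow> F' (h, y) = F (h, y)"
    by (auto simp: F'_def p)
  have new1: "dist z0 (F' (h, y)) \<le> b h \<and> (\<forall>a\<in>A. dist (F' (h, y)) (h a) \<le> L h * dist y a)"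
    if "(h, y) \<in> insert p S" for h y
    using that q0 qA F0 FA F' p by (cases "(h, y) = (g, x)") auto
  have new2: "(dist (F' (h, y)) (F' (k, z)))\<^sup>2 \<le> (max (L h) (L k))\<^sup>2 * (dist y z)\<^sup>2 + K h k"
    if hy: "(h, y) \<in> insert p S" and kz: "(k, z) \<in> insert p S" for h y k z
  proof (cases "(h, y) = (g, x)")
    case True
    show ?thesis
    proof (cases "(k, z) = (g, x)")
      case True
      with \<open>(h, y) = (g, x)\<close> show ?thesis using K(1)[OF g] by simp
    next
      case False
      then show ?thesis using True kz qS[of k z] F' p by auto
    qed
  next
    case hyn: False
    then have hy: "(h, y) \<in> S" using hy p by auto
    show ?thesis
    proof (cases "(k, z) = (g, x)")
      case True
      then show ?thesis
        using qS[OF hy] F' hyn K(2)[OF g SJ[OF hy]] by (simp add: dist_commute max.commute)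
    next
      case False
      then show ?thesis using hyn hy kz FF[of h y k z] F' p by auto
    qed
  qed
  show ?case
  proof (intro exI[of _ F'] ballI)
    fix r assume "r \<in> insert p S"
    moreover obtain h y where r: "r = (h, y)" by (cases r)
    ultimately have hy: "(h, y) \<in> insert p S" by simp
    have "\<forall>(k, z) \<in> insert p S.
        (dist (F' (h, y)) (F' (k, z)))\<^sup>2 \<le> (max (L h) (L k))\<^sup>2 * (dist y z)\<^sup>2 + K h k"
      by (rule ballI) (simp only: split_paired_all case_prod_conv new2[OF hy])
    then show "case r of (h, y) \<Rightarrow> dist z0 (F' (h, y)) \<le> b h \<and>
      (\<forall>a\<in>A. dist (F' (h, y)) (h a) \<le> L h * dist y a) \<and>
      (\<forall>(k, z) \<in> insert p S.
        (dist (F' (h, y)) (F' (k, z)))\<^sup>2 \<le> (max (L h) (L k))\<^sup>2 * (dist y z)\<^sup>2 + K h k)"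
      using new1[OF hy] unfolding r case_prod_conv by (elim conjE) (intro conjI; assumption)
  qed
qed

text \<open>Every constraint involves at most two pairs, so it holds eventually along the finite
  sets of pairs and passes to the asymptotic centres.\<close>

lemma simultaneous_extension:
  fixes A :: "'a::metric_space set" and J :: "('a \<Rightarrow> 'b::complete_space) set"
  assumes cbb: "CBB0 TYPE('a)" and cat: "CAT0 TYPE('b)"
    and L: "\<And>g. g \<in> J \<Longrightarrow> (L g)-lipschitz_on A g"
    and b: "\<And>g a. g \<in> J \<Longrightarrow> a \<in> A \<Longrightarrow> dist z0 (g a) \<le> b g"
    and \<rho>: "\<And>g h a. g \<in> J \<Longrightarrow> h \<in> J \<Longrightarrow> a \<in> A \<Longrightarrow> dist (g a) (h a) \<le> \<rho> g h"
      "\<And>g h. g \<in> J \<Longrightarrow> h \<in> J \<Longrightarrow> b g \<le> b h + \<rho> g h"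
      "\<And>g h. g \<in> J \<Longrightarrow> h \<in> J \<Longrightarrow> \<rho> g h \<le> b g + b h"
      "\<And>g h. g \<in> J \<Longrightarrow> h \<in> J \<Longrightarrow> \<rho> g h = \<rho> h g"
    and K: "\<And>g. g \<in> J \<Longrightarrow> K g g = 0"
      "\<And>g h. g \<in> J \<Longrightarrow> h \<in> J \<Longrightarrow> K g h = K h g"
      "\<And>g h k. g \<in> J \<Longrightarrow> h \<in> J \<Longrightarrow> k \<in> J \<Longrightarrow> K g k \<le> K g h + K h k"
      "\<And>g h. g \<in> J \<Longrightarrow> h \<in> J \<Longrightarrow> 6 * max (b g) (b h) * \<rho> g h \<le> K g h"
    and A: "A \<noteq> {}"
  obtains F where
    "\<And>g x. g \<in> J \<Longrightarrow> dist z0 (F g x) \<le> b g"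
    "\<And>g a. g \<in> J \<Longrightarrow> a \<in> A \<Longrightarrow> F g a = g a"
    "\<And>g x y. g \<in> J \<Longrightarrow> dist (F g x) (F g y) \<le> L g * dist x y"
    "\<And>g h x. g \<in> J \<Longrightarrow> h \<in> J \<Longrightarrow> dist (F g x) (F h x) \<le> sqrt (K g h)"
proof -
  define Q where "Q S F \<longleftrightarrow> (\<forall>(g, x) \<in> S. dist z0 (F (g, x)) \<le> b g \<and>
    (\<forall>a\<in>A. dist (F (g, x)) (g a) \<le> L g * dist x a) \<and>
    (\<forall>(h, y) \<in> S. (dist (F (g, x)) (F (h, y)))\<^sup>2 \<le> (max (L g) (L h))\<^sup>2 * (dist x y)\<^sup>2 + K g h))" for S and F :: "('a \<Rightarrow> 'b) \<times> 'a \<Rightarrow> 'b"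
  have "\<exists>F. Q (S \<inter> J \<times> UNIV) F" if "finite S" for S
    unfolding Q_def
    by (rule finite_simultaneous_extension[OF cbb cat, where J = J and \<rho> = \<rho>];
        (rule L b \<rho> K A; assumption)?) (use that in auto)
  then obtain E where E: "\<And>S. finite S \<Longrightarrow> Q (S \<inter> J \<times> UNIV) (E S)"
    by metis
  have E0: "dist z0 (E S (g, x)) \<le> b g" and EA: "a \<in> A \<Longrightarrow> dist (E S (g, x)) (g a) \<le> L g * dist x a"
    if "finite S" "(g, x) \<in> S" "g \<in> J" for S g x a
    using E[OF that(1)] that(2,3) unfolding Q_def by auto
  have EE: "(dist (E S (g, x)) (E S (h, y)))\<^sup>2 \<le> (max (L g) (L h))\<^sup>2 * (dist x y)\<^sup>2 + K g h"
    if "finite S" "(g, x) \<in> S" "g \<in> J" "(h, y) \<in> S" "h \<in> J" for S g x h y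
    using E[OF that(1)] that(2-) unfolding Q_def by fast
  define f where "f S p = (if finite S \<and> p \<in> S \<and> fst p \<in> J then E S p else z0)" for S p
  \<comment> \<open>Nothing is known about b outside J, where f is constantly z0; the truncation at
    0 covers that case.\<close>
  have "dist z0 (f S p) \<le> max 0 (b (fst p))" for S p
    using E0[of S "fst p" "snd p"] by (auto simp: f_def le_max_iff_disj)
  then obtain \<phi> where
    \<phi>1: "\<And>p y D. \<forall>\<^sub>F S in finite_subsets_at_top UNIV. dist (f S p) y \<le> D \<Longrightarrow> dist (\<phi> p) y \<le> D" and
    \<phi>2: "\<And>p q D. \<forall>\<^sub>F S in finite_subsets_at_top UNIV. dist (f S p) (f S q) \<le> D \<Longrightarrow> dist (\<phi> p) (\<phi> q) \<le> D"
    by (rule asymptotic_centre[OF cat finite_subsets_at_top_neq_bot[of UNIV], where f = f]) (rule that)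
  have ev: "\<forall>\<^sub>F S in finite_subsets_at_top UNIV. finite S \<and> p \<in> S \<and> q \<in> S" for p q :: "('a \<Rightarrow> 'b) \<times> 'a"
    unfolding eventually_finite_subsets_at_top by (intro exI[of _ "{p, q}"]) auto
  have Fd: "dist (\<phi> (g, x)) (\<phi> (h, y)) \<le> sqrt ((max (L g) (L h))\<^sup>2 * (dist x y)\<^sup>2 + K g h)"
    if "g \<in> J" "h \<in> J" for g h x y
  proof (rule \<phi>2)
    show "\<forall>\<^sub>F S in finite_subsets_at_top UNIV. dist (f S (g, x)) (f S (h, y)) \<le>
        sqrt ((max (L g) (L h))\<^sup>2 * (dist x y)\<^sup>2 + K g h)"
      using ev[of "(g, x)" "(h, y)"]
      by eventually_elim (use EE that in \<open>auto simp: f_def intro!: real_le_rsqrt\<close>)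
  qed
  have L0: "0 \<le> L g" if "g \<in> J" for g
    using L[OF that] lipschitz_on_nonneg by blast
  show ?thesis
  proof (rule that[of "\<lambda>g x. \<phi> (g, x)"])
    fix g x assume g: "g \<in> J"
    have "\<forall>\<^sub>F S in finite_subsets_at_top UNIV. dist (f S (g, x)) z0 \<le> b g"
      using ev[of "(g, x)" "(g, x)"]
      by eventually_elim (use E0 g in \<open>auto simp: f_def dist_commute\<close>)
    then show "dist z0 (\<phi> (g, x)) \<le> b g"
      using \<phi>1 dist_commute by metis
  next
    fix g a assume g: "g \<in> J" and a: "a \<in> A"
    have "\<forall>\<^sub>F S in finite_subsets_at_top UNIV. dist (f S (g, a)) (g a) \<le> 0"
      using ev[of "(g, a)" "(g, a)"]
      by eventually_elim (use EA[of _ g a a] g a in \<open>auto simp: f_def\<close>)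
    then have "dist (\<phi> (g, a)) (g a) \<le> 0" by (rule \<phi>1)
    then show "\<phi> (g, a) = g a" by simp
  next
    fix g x y assume g: "g \<in> J"
    show "dist (\<phi> (g, x)) (\<phi> (g, y)) \<le> L g * dist x y"
      using Fd[OF g g, of x y] K(1)[OF g] L0[OF g] by (simp add: real_sqrt_mult)
  next
    fix g h x assume "g \<in> J" "h \<in> J"
    then show "dist (\<phi> (g, x)) (\<phi> (h, x)) \<le> sqrt (K g h)"
      using Fd[of g h x x] by simp
  qed
qed

section \<open>Lipschitz constants, the supremum distance and the final operator\<close>

text \<open>The infimum is attained, since every difference quotient is a lower bound of the
  admissible constants.\<close>

lemma Lip_lipschitz_on:
  assumes "C-lipschitz_on A g"
  shows "(Lip g A)-lipschitz_on A g"
proof (rule lipschitz_onI)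
  let ?S = "{L. L-lipschitz_on A g}"
  have S: "?S \<noteq> {}" using assms by blast
  show "0 \<le> Lip g A"
    unfolding Lip_def using S by (intro cInf_greatest) (auto dest: lipschitz_on_nonneg)
  fix x y assume xy: "x \<in> A" "y \<in> A"
  show "dist (g x) (g y) \<le> Lip g A * dist x y"
  proof (cases "x = y")
    case False
    have "dist (g x) (g y) / dist x y \<le> L" if "L \<in> ?S" for L
      using lipschitz_onD[of L A g x y] that xy False by (simp add: divide_le_eq)
    then have "dist (g x) (g y) / dist x y \<le> Lip g A"
      unfolding Lip_def using S by (intro cInf_greatest)
    then show ?thesis using False by (simp add: divide_le_eq)
  qed simp
qed

lemma Lip_extension:
  assumes "(Lip g A)-lipschitz_on UNIV f" "\<And>a. a \<in> A \<Longrightarrow> f a = g a"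
  shows "Lip f UNIV = Lip g A"
proof (rule antisym)
  have low: "bdd_below {L. L-lipschitz_on B k}" for B and k :: "'a \<Rightarrow> 'b"
    by (rule bdd_belowI[of _ 0]) (auto dest: lipschitz_on_nonneg)
  show "Lip f UNIV \<le> Lip g A"
    unfolding Lip_def[of f] using assms(1) low by (intro cInf_lower) auto
  show "Lip g A \<le> Lip f UNIV"
    unfolding Lip_def
  proof (rule cInf_superset_mono)
    show "{L. L-lipschitz_on UNIV f} \<noteq> {}" using assms(1) by blast
    show "bdd_below {L. L-lipschitz_on A g}" by (rule low)
    show "{L. L-lipschitz_on UNIV f} \<subseteq> {L. L-lipschitz_on A g}"
      using assms(2) by (auto simp: lipschitz_on_def) metis
  qed
qed

lemma Lmaps_dist_le_supdist:
  assumes "g \<in> Lmaps A" "h \<in> Lmaps A" "a \<in> A"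
  shows "dist (g a) (h a) \<le> supdist A g h"
proof -
  have "bounded (g ` A)" "bounded (h ` A)"
    using assms by (auto simp: Lmaps_def)
  then obtain B C where "\<forall>x\<in>A. dist (h a) (h x) \<le> C"
    and "\<forall>x\<in>A. dist (h a) (g x) \<le> B"
    unfolding bounded_any_center[of _ "h a"] by auto
  then have "\<forall>x\<in>A. dist (g x) (h x) \<le> B + C"
    by (meson add_mono dist_triangle3 order_trans)
  then show ?thesis
    unfolding supdist_def using assms(3) by (intro cSUP_upper bdd_aboveI2[where M = "B + C"]) auto
qed

theorem theorem4p5:
  fixes A :: "'a::metric_space set"
  assumes "CBB0 TYPE('a)"
    and "CAT0 TYPE('b::complete_space)"
    and "A \<noteq> {}"
  shows "\<exists>\<beta> :: ('a \<Rightarrow> 'b) \<Rightarrow> ('a \<Rightarrow> 'b).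
           (\<forall>g\<in>Lmaps A. \<beta> g \<in> Lmaps UNIV) \<and>
           (\<forall>g\<in>Lmaps A. \<forall>\<epsilon>>0. \<exists>\<delta>>0. \<forall>h\<in>Lmaps A.
               supdist A g h < \<delta> \<longrightarrow> supdist UNIV (\<beta> g) (\<beta> h) < \<epsilon>) \<and>
           (\<forall>g\<in>Lmaps A.
               (\<forall>a\<in>A. \<beta> g a = g a) \<and>
               Lip (\<beta> g) UNIV = Lip g A \<and>
               \<beta> g ` UNIV \<subseteq> closure (co (g ` A)))"
proof -
  note cbb = assms(1) and cat = assms(2)
  define J :: "('a \<Rightarrow> 'b) set" where "J = Lmaps A"
  obtain a0 where a0: "a0 \<in> A" using assms(3) by blast
  define z0 :: 'b where "z0 = undefined"
  define \<rho> where "\<rho> = (supdist A :: ('a \<Rightarrow> 'b) \<Rightarrow> ('a \<Rightarrow> 'b) \<Rightarrow> real)"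
  define b where "b g = (SUP a\<in>A. dist z0 (g a))" for g :: "'a \<Rightarrow> 'b"
  have L: "(Lip g A)-lipschitz_on A g" if "g \<in> J" for g
    using that Lip_lipschitz_on by (auto simp: J_def Lmaps_def)
  have \<rho>1: "dist (g a) (h a) \<le> \<rho> g h" if "g \<in> J" "h \<in> J" "a \<in> A" for g h a
    using that Lmaps_dist_le_supdist unfolding J_def \<rho>_def by blast
  have \<rho>least: "\<rho> g h \<le> M" if "\<And>a. a \<in> A \<Longrightarrow> dist (g a) (h a) \<le> M" for g h M
    unfolding \<rho>_def supdist_def using that assms(3) by (intro cSUP_least)
  have b: "dist z0 (g a) \<le> b g" if "g \<in> J" "a \<in> A" for g a
  proof -
    have "bounded (g ` A)" using that by (auto simp: J_def Lmaps_def)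
    then obtain B where "\<forall>x\<in>A. dist z0 (g x) \<le> B"
      unfolding bounded_any_center[of _ z0] by auto
    then show ?thesis
      unfolding b_def using that(2) by (intro cSUP_upper bdd_aboveI2[where M = B]) auto
  qed
  have bleast: "b g \<le> M" if "\<And>a. a \<in> A \<Longrightarrow> dist z0 (g a) \<le> M" for g M
    unfolding b_def using that assms(3) by (intro cSUP_least)
  have \<rho>refl: "\<rho> g g = 0" for g
    using assms(3) by (simp add: \<rho>_def supdist_def)
  have \<rho>sym: "\<rho> g h = \<rho> h g" for g h
    by (simp add: \<rho>_def supdist_def dist_commute)
  have \<rho>tri: "\<rho> g k \<le> \<rho> g h + \<rho> h k" if "g \<in> J" "h \<in> J" "k \<in> J" for g h k
    by (rule \<rho>least) (meson \<rho>1 that add_mono dist_triangle order_trans)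
  have b\<rho>: "b g \<le> b h + \<rho> g h" if "g \<in> J" "h \<in> J" for g h
  proof (rule bleast)
    fix a assume "a \<in> A"
    then show "dist z0 (g a) \<le> b h + \<rho> g h"
      using b[OF that(2)] \<rho>1[OF that] dist_triangle2[of z0 "g a" "h a"] by force
  qed
  have \<rho>b: "\<rho> g h \<le> b g + b h" if "g \<in> J" "h \<in> J" for g h
  proof (rule \<rho>least)
    fix a assume "a \<in> A"
    then show "dist (g a) (h a) \<le> b g + b h"
      using b[OF that(1)] b[OF that(2)] dist_triangle3[of "g a" "h a" z0] by force
  qed
  obtain K where K: "\<And>g. g \<in> J \<Longrightarrow> K g g = 0"
    "\<And>g h. g \<in> J \<Longrightarrow> h \<in> J \<Longrightarrow> K g h = K h g"
    "\<And>g h k. g \<in> J \<Longrightarrow> h \<in> J \<Longrightarrow> k \<in> J \<Longrightarrow> K g k \<le> K g h + K h k"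
    "\<And>g h. g \<in> J \<Longrightarrow> h \<in> J \<Longrightarrow> 6 * max (b g) (b h) * \<rho> g h \<le> K g h"
    and K48: "\<And>g h. g \<in> J \<Longrightarrow> h \<in> J \<Longrightarrow> K g h \<le> 48 * max (b g) (b h) * \<rho> g h"
    by (rule weighted_pseudometric[of J \<rho> b]; (rule \<rho>refl \<rho>sym \<rho>tri b\<rho> \<rho>b; assumption)?)
      (rule that)
  obtain F where F0: "\<And>g x. g \<in> J \<Longrightarrow> dist z0 (F g x) \<le> b g"
    and FA: "\<And>g a. g \<in> J \<Longrightarrow> a \<in> A \<Longrightarrow> F g a = g a"
    and FL: "\<And>g x y. g \<in> J \<Longrightarrow> dist (F g x) (F g y) \<le> Lip g A * dist x y"
    and FK: "\<And>g h x. g \<in> J \<Longrightarrow> h \<in> J \<Longrightarrow> dist (F g x) (F h x) \<le> sqrt (K g h)"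
    by (rule simultaneous_extension[OF cbb cat, of J "\<lambda>g. Lip g A" A z0 b \<rho> K];
        (rule L b \<rho>1 b\<rho> \<rho>b \<rho>sym K assms(3); assumption)?)
      (rule that)
  define C where "C g = closure (co (g ` A))" for g :: "'a \<Rightarrow> 'b"
  have inC: "g a \<in> C g" if "a \<in> A" for g a
    unfolding C_def using that subset_co[of "g ` A"] closure_subset[of "co (g ` A)"] by blast
  have "co (g ` A) \<noteq> {}" for g :: "'a \<Rightarrow> 'b"
    using assms(3) subset_co[of "g ` A"] by blast
  then have "\<exists>u. nearest (C g) y u" for g y
    unfolding C_def by (intro nearest_exists[OF cat _ G1_co])
  then obtain \<pi> where \<pi>: "\<And>g y. nearest (C g) y (\<pi> g y)" by metis
  define \<beta> where "\<beta> g x = \<pi> g (F g x)" for g x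
  have \<beta>L: "(Lip g A)-lipschitz_on UNIV (\<beta> g)" if "g \<in> J" for g
  proof (rule lipschitz_onI)
    show "dist (\<beta> g x) (\<beta> g y) \<le> Lip g A * dist x y" for x y
      unfolding \<beta>_def by (rule order_trans[OF nearest_nonexpansive[OF cat \<pi> \<pi>] FL[OF that]])
    show "0 \<le> Lip g A" using L[OF that] lipschitz_on_nonneg by blast
  qed
  \<comment> \<open>The prescribed value already lies in the hull, so the projection fixes
    it.\<close>
  have \<beta>A: "\<beta> g a = g a" if "g \<in> J" "a \<in> A" for g a
    using nearest_dist_le(2)[OF \<pi> inC[OF that(2)], of g "g a"] FA[OF that] by (simp add: \<beta>_def)
  have \<beta>C: "\<beta> g ` UNIV \<subseteq> C g" for g
    using \<pi> unfolding nearest_def \<beta>_def by blast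
  have Fga: "dist (F g x) (g a0) \<le> 2 * b g" if "g \<in> J" for g x
    using F0[OF that, of x] b[OF that a0] dist_triangle3[of "F g x" "g a0" z0] by linarith
  have \<beta>M: "\<beta> g \<in> Lmaps UNIV" if "g \<in> J" for g
  proof -
    have "dist (g a0) (\<beta> g x) \<le> 2 * b g" for x
      using nearest_dist_le(2)[OF \<pi> inC[OF a0], of g "F g x"] Fga[OF that, of x]
      by (simp add: \<beta>_def dist_commute)
    then have "bounded (range (\<beta> g))"
      unfolding bounded_def by blast
    then show ?thesis
      unfolding Lmaps_def using \<beta>L[OF that] by auto
  qed
  have cont: "\<exists>\<delta>>0. \<forall>h\<in>J. \<rho> g h < \<delta> \<longrightarrow> supdist UNIV (\<beta> g) (\<beta> h) < \<epsilon>" if g: "g \<in> J" and "\<epsilon> > 0" for g \<epsilon>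
  proof -
    \<comment> \<open>The first root bounds the effect of moving the point, through
      \<open>K48\<close>; the rest is \<open>nearest_stable\<close> with e = \<delta> and distance
      bound \<open>2 * (b g + \<delta>)\<close>. It tends to 0 with \<delta> for fixed g.\<close>
    define B where "B \<delta> = sqrt (48 * (b g + \<delta>) * \<delta>) + (\<delta> + sqrt (4 * \<delta> * (2 * (b g + \<delta>)) + 4 * \<delta>\<^sup>2))" for \<delta>
    have "(B \<longlongrightarrow> sqrt (48 * (b g + 0) * 0) + (0 + sqrt (4 * 0 * (2 * (b g + 0)) + 4 * 0\<^sup>2))) (at_right 0)"
      unfolding B_def by (intro tendsto_intros)
    then have "\<forall>\<^sub>F \<delta> in at_right 0. B \<delta> < \<epsilon>"
      using \<open>\<epsilon> > 0\<close> by (intro order_tendstoD(2)) auto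
    then obtain d where "d > 0" and d: "\<And>\<delta>. 0 < \<delta> \<Longrightarrow> \<delta> < d \<Longrightarrow> B \<delta> < \<epsilon>"
      unfolding eventually_at_right_field by auto
    define \<delta> where "\<delta> = d / 2"
    have \<delta>: "0 < \<delta>" "B \<delta> < \<epsilon>" using \<open>d > 0\<close> d by (auto simp: \<delta>_def)
    have "supdist UNIV (\<beta> g) (\<beta> h) < \<epsilon>" if h: "h \<in> J" and r: "\<rho> g h < \<delta>" for h
    proof -
      have bh: "b h \<le> b g + \<delta>" using b\<rho>[OF h g] \<rho>sym[of g h] r by simp
      have b0: "0 \<le> b g" using b[OF g a0] by (meson order_trans zero_le_dist)
      have \<rho>0: "0 \<le> \<rho> g h" using \<rho>1[OF g h a0] by (meson order_trans zero_le_dist)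
      have near: "\<exists>z'\<in>C k. dist z z' \<le> \<delta>" if "z \<in> C j" "j \<in> J" "k \<in> J" "\<rho> j k < \<delta>" for j k z
        using closure_co_near[OF cat \<rho>1[OF that(2,3)] that(1)[unfolded C_def] that(4)] unfolding C_def .
      have "dist (\<beta> g x) (\<beta> h x) \<le> B \<delta>" for x
      proof -
        \<comment> \<open>The intermediate point separates the two changes: first the projected
          point at a fixed hull, then the hull at a fixed point.\<close>
        have "dist (\<beta> g x) (\<pi> g (F h x)) \<le> dist (F g x) (F h x)"
          unfolding \<beta>_def by (rule nearest_nonexpansive[OF cat \<pi> \<pi>])
        also have "\<dots> \<le> sqrt (K g h)" by (rule FK[OF g h])
        also have "K g h \<le> 48 * max (b g) (b h) * \<rho> g h" by (rule K48[OF g h])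
        also have "\<dots> \<le> 48 * (b g + \<delta>) * \<delta>"
          using bh b0 r \<rho>0 \<delta> by (intro mult_mono) auto
        finally have 1: "dist (\<beta> g x) (\<pi> g (F h x)) \<le> sqrt (48 * (b g + \<delta>) * \<delta>)"
          by simp
        have "dist (F h x) (\<pi> h (F h x)) \<le> dist (F h x) (h a0)"
          by (rule nearest_dist_le(1)[OF \<pi> inC[OF a0]])
        also have "\<dots> \<le> 2 * (b g + \<delta>)" using Fga[OF h, of x] bh by simp
        finally have "dist (\<pi> g (F h x)) (\<pi> h (F h x)) \<le> \<delta> + sqrt (4 * \<delta> * (2 * (b g + \<delta>)) + 4 * \<delta>\<^sup>2)"
          using near g h r \<rho>sym by (intro nearest_stable[OF \<pi> \<pi>]) auto
        with 1 show ?thesis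
          using dist_triangle[of "\<beta> g x" "\<beta> h x" "\<pi> g (F h x)"] by (simp add: \<beta>_def B_def)
      qed
      then have "supdist UNIV (\<beta> g) (\<beta> h) \<le> B \<delta>"
        unfolding supdist_def by (intro cSUP_least) auto
      then show ?thesis using \<delta> by simp
    qed
    then show ?thesis using \<delta> by blast
  qed
  have \<beta>Lip: "Lip (\<beta> g) UNIV = Lip g A" if "g \<in> J" for g
    by (rule Lip_extension[OF \<beta>L[OF that] \<beta>A[OF that]])
  show ?thesis
    by (intro exI[of _ \<beta>] conjI ballI allI impI)
      (fold J_def C_def \<rho>_def, simp_all add: \<beta>M cont \<beta>A \<beta>Lip \<beta>C del: image_subset_iff)
qed

end
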